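(* Let $\mathbf{w}=(\mathbf{w}_n)_{n\ge0}$ be a sequence in $\{1,2,3\}^{\mathbb{N}}$ in which $3$ appears infinitely many times, and let $(n_j)_{j\ge0}$ be an increasing sequence of positive integers such that $$\sum_{j\ge0}(n_{j+1}-n_j)\,\|A^{(\mathbf{w}_{[0,n_j)})}\|_{D^{(\mathbf{w}_{[0,n_j)})}}<+\infty.$$ Let $(X,T)$ be a finite rank minimal Cantor system given by a Bratteli-Vershik representation whose incidence matrices are $M_1=h_1=(1,1,1)$ and $M_n=A^{(\mathbf{w}_{n-2})}$ for $n\ge2$. Then $(X,T)$ is uniquely ergodic and there exists a real vector $\nu=(\nu(1),\nu(2),\nu(3))^T\in D$ with rationally independent entries such that $$E(X,T)=I(X,T)=\nu(1)\mathbb{Z}+\nu(2)\mathbb{Z}+\mathbb{Z}.$$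
   Context: Matrices. Let $$B^{(1)}=\begin{pmatrix}1&1&0\\0&1&0\\0&0&1\end{pmatrix},\quad B^{(2)}=\begin{pmatrix}1&1&0\\1&0&0\\0&0&1\end{pmatrix},\quad B^{(3)}=\begin{pmatrix}1&0&1\\1&0&0\\0&1&0\end{pmatrix},$$ and $A^{(1)}=B^{(1)}$, $A^{(2)}=B^{(2)}$, $A^{(3)}=(B^{(3)})^6$ (all entries of $A^{(3)}$ are positive). For a word $w=w_1\cdots w_n$ on $\{1,2,3\}$, $A^{(w)}=A^{(w_1)}\cdots A^{(w_n)}$. Let $D=\{(x_1,x_2,x_3)^T\in\mathbb{R}^3:x_1>x_2>x_3>0\}$ and $D^{(w)}=A^{(w)}D$. $\mathbf{w}_{[0,n)}=\mathbf{w}_0\cdots\mathbf{w}_{n-1}$. $\|\cdot\|$ is the supremum norm on $\mathbb{R}^3$. For a real $3\times3$ matrix $M$ and a column vector $x$, $\|M\|_x=\sup\{\|zM\|:z\text{ a row vector},\|z\|=1,\ z\cdot x=0\}$, and for a set $R$ of column vectors $\|M\|_R=\sup_{x\in R}\|M\|_x$. Systems. A minimal Cantor system $(X,T)$ is a homeomorphism $T$ of a Cantor set $X$ all of whose orbits are dense. $\lambda$ is a continuous eigenvalue if there is a continuous $f:X\to\mathbb{C}$, $f\ne0$, with $f\circ T=\lambda f$. $E(X,T)=\{\alpha\in\mathbb{R}:\exp(2i\pi\alpha)\text{ is a continuous eigenvalue of }(X,T)\}$, and $I(X,T)=\bigcap_{\mu\in\mathcal{M}(X,T)}\{\int_Xf\,d\mu:f\in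 C(X,\mathbb{Z})\}$, where $\mathcal{M}(X,T)$ is the set of $T$-invariant Borel probability measures and $C(X,\mathbb{Z})$ the set of continuous functions $X\to\mathbb{Z}$. Bratteli-Vershik representations. A Bratteli diagram $(V,E)$ is an infinite graph with finite pairwise disjoint vertex levels $V_0=\{v_0\},V_1,V_2,\dots$ and finite edge levels $E_1,E_2,\dots$, each $e\in E_n$ going from a source in $V_{n-1}$ to a range in $V_n$, every vertex being the source of some edge and every vertex other than $v_0$ the range of some edge. The incidence matrix $M_n$ is the $V_{n-1}\times V_n$ matrix whose $(u,v)$ entry is the number of edges from $u$ to $v$; $h_1=M_1$. Here $V_n=\{1,2,3\}$ for $n\ge1$. The diagram is simple if for every $m\ge1$ there is $n>m$ such that every $u\in V_m$ is joined by a path to every $v\in V_n$. An ordered diagram $B=(V,E,\preceq)$ carries a partial order on $E$ in which two edges are comparable iff they have the same range. $X_B$ is the space of infinite paths from $v_0$ with the cylinder topology. $B$ is properly ordered if there is a unique infinite path $x_{\max}$ with all edges maximal and a unique $x_{\min}$ with all edges minimal. The Vershik map $V_B$ sends $x_{\max}$ to $x_{\min}$ and sends $x\ne x_{\max}$ to the path obtained by taking the smallest $n$ with $x_n$ not maximal, replacing $x_n$ by its successor $y_n$, replacing $(x_1,\dots,x_{n-1})$ by the minimal path from $v_0$ to the source of $y_n$, and leaving the rest unchanged. A Bratteli-Vershik representation of $(X,T)$ is a properly ordered simple $B$ with $(X,T)$ topologically conjugate to $(X_B,V_B)$. Finite rank means that $\#V_n$ is uniformly bounded. *)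

theory Defs
  imports "HOL-Probability.Probability_Measure"
begin

section \<open>Matrices\<close>

(* The argument of vector is the list of rows.  The index type 3 has exactly the
   elements 1, 2, 3 (with 3 = 0 in that type).  Letters are natural numbers. *)

definition matB :: "nat \<Rightarrow> real^3^3" where
  "matB k =
    (if k = 1 then vector [vector [1, 1, 0], vector [0, 1, 0], vector [0, 0, 1]]
     else if k = 2 then vector [vector [1, 1, 0], vector [1, 0, 0], vector [0, 0, 1]]
     else vector [vector [1, 0, 1], vector [1, 0, 0], vector [0, 1, 0]])"

(* The power is iterated (**), since * on vectors and matrices is componentwise. *)
definition matA :: "nat \<Rightarrow> real^3^3" where
  "matA k = (if k = 1 \<or> k = 2 then matB k else (((**) (matB 3)) ^^ 6) (mat 1))"

definition matA_word :: "nat list \<Rightarrow> real^3^3" where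
  "matA_word u = foldr (\<lambda>k M. matA k ** M) u (mat 1)"

definition prefix_word :: "(nat \<Rightarrow> nat) \<Rightarrow> nat \<Rightarrow> nat list" where
  "prefix_word w n = map w [0..<n]"

definition coneD :: "(real^3) set" where
  "coneD = {x. x $ 1 > x $ 2 \<and> x $ 2 > x $ 3 \<and> x $ 3 > 0}"

definition coneD_word :: "nat list \<Rightarrow> (real^3) set" where
  "coneD_word u = (\<lambda>x. matA_word u *v x) ` coneD"

(* infnorm is the supremum norm, and z v* M is the product of the row vector z with M.
   Both suprema below are of nonempty (for R nonempty) sets of reals bounded above by the
   sum of the absolute values of the entries of M. *)
definition mnorm_at :: "real^3^3 \<Rightarrow> real^3 \<Rightarrow> real" where
  "mnorm_at M x = Sup {infnorm (z v* M) | z. infnorm z = 1 \<and> z \<bullet> x = 0}"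

definition mnorm_on :: "real^3^3 \<Rightarrow> (real^3) set \<Rightarrow> real" where
  "mnorm_on M R = (SUP x\<in>R. mnorm_at M x)"

definition rationally_independent :: "real^3 \<Rightarrow> bool" where
  "rationally_independent v \<longleftrightarrow>
    (\<forall>q :: 3 \<Rightarrow> rat. (\<Sum>i\<in>UNIV. of_rat (q i) * v $ i) = 0 \<longrightarrow> (\<forall>i. q i = 0))"


section \<open>Minimal Cantor systems\<close>

definition cantor_set :: "'x topology \<Rightarrow> bool" where
  "cantor_set X \<longleftrightarrow>
    X homeomorphic_space product_topology (\<lambda>_ :: nat. discrete_topology (UNIV :: bool set)) UNIV"

definition full_orbit :: "'x topology \<Rightarrow> ('x \<Rightarrow> 'x) \<Rightarrow> 'x \<Rightarrow> 'x set" where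
  "full_orbit X T x = {y \<in> topspace X. \<exists>n. y = (T ^^ n) x \<or> (T ^^ n) y = x}"

definition minimal_cantor_system :: "'x topology \<Rightarrow> ('x \<Rightarrow> 'x) \<Rightarrow> bool" where
  "minimal_cantor_system X T \<longleftrightarrow>
    cantor_set X \<and> homeomorphic_map X X T \<and>
    (\<forall>x \<in> topspace X. X closure_of (full_orbit X T x) = topspace X)"

definition continuous_eigenvalue :: "'x topology \<Rightarrow> ('x \<Rightarrow> 'x) \<Rightarrow> complex \<Rightarrow> bool" where
  "continuous_eigenvalue X T c \<longleftrightarrow>
    (\<exists>f. continuous_map X euclidean f \<and> (\<exists>x \<in> topspace X. f x \<noteq> 0) \<and>
         (\<forall>x \<in> topspace X. f (T x) = c * f x))"

definition eigenvalue_group :: "'x topology \<Rightarrow> ('x \<Rightarrow> 'x) \<Rightarrow> real set" where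
  "eigenvalue_group X T =
    {\<alpha>. continuous_eigenvalue X T (exp (2 * \<i> * complex_of_real pi * complex_of_real \<alpha>))}"

definition borel_algebra :: "'x topology \<Rightarrow> 'x measure" where
  "borel_algebra X = sigma (topspace X) {U. openin X U}"

definition invariant_measures :: "'x topology \<Rightarrow> ('x \<Rightarrow> 'x) \<Rightarrow> 'x measure set" where
  "invariant_measures X T =
    {\<mu>. prob_space \<mu> \<and> space \<mu> = topspace X \<and> sets \<mu> = sets (borel_algebra X) \<and>
        T \<in> measurable \<mu> \<mu> \<and> distr \<mu> \<mu> T = \<mu>}"

definition uniquely_ergodic :: "'x topology \<Rightarrow> ('x \<Rightarrow> 'x) \<Rightarrow> bool" where
  "uniquely_ergodic X T \<longleftrightarrow> (\<exists>!\<mu>. \<mu> \<in> invariant_measures X T)"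

definition integral_image_group :: "'x topology \<Rightarrow> ('x \<Rightarrow> 'x) \<Rightarrow> real set" where
  "integral_image_group X T =
    (\<Inter>\<mu> \<in> invariant_measures X T.
      {\<integral>x. real_of_int (f x) \<partial>\<mu> | f. continuous_map X (discrete_topology (UNIV :: int set)) f})"


section \<open>Bratteli-Vershik representations\<close>

(* Edge levels are E_1, E_2, ...; the value of edges at 0 plays no role.
   edge_order is only meaningful on the union of the edge levels. *)
record ('v, 'e) bratteli =
  verts :: "nat \<Rightarrow> 'v set"
  edges :: "nat \<Rightarrow> 'e set"
  src :: "'e \<Rightarrow> 'v"
  rng :: "'e \<Rightarrow> 'v"
  edge_order :: "('e \<times> 'e) set"

definition all_edges :: "('v, 'e) bratteli \<Rightarrow> 'e set" where
  "all_edges B = (\<Union>n\<in>{1..}. edges B n)"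

definition bratteli_diagram :: "('v, 'e) bratteli \<Rightarrow> bool" where
  "bratteli_diagram B \<longleftrightarrow>
    (\<exists>v0. verts B 0 = {v0}) \<and>
    (\<forall>n. finite (verts B n)) \<and>
    (\<forall>m n. m \<noteq> n \<longrightarrow> verts B m \<inter> verts B n = {}) \<and>
    (\<forall>n\<ge>1. finite (edges B n)) \<and>
    (\<forall>n\<ge>1. \<forall>e \<in> edges B n. src B e \<in> verts B (n - 1) \<and> rng B e \<in> verts B n) \<and>
    (\<forall>n. \<forall>v \<in> verts B n. \<exists>e \<in> edges B (Suc n). src B e = v) \<and>
    (\<forall>n\<ge>1. \<forall>v \<in> verts B n. \<exists>e \<in> edges B n. rng B e = v)"

definition ordered_bratteli_diagram :: "('v, 'e) bratteli \<Rightarrow> bool" where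
  "ordered_bratteli_diagram B \<longleftrightarrow>
    bratteli_diagram B \<and>
    partial_order_on (all_edges B) (edge_order B) \<and>
    (\<forall>e \<in> all_edges B. \<forall>f \<in> all_edges B.
      (e, f) \<in> edge_order B \<or> (f, e) \<in> edge_order B \<longleftrightarrow> rng B e = rng B f)"

definition incidence :: "('v, 'e) bratteli \<Rightarrow> nat \<Rightarrow> 'v \<Rightarrow> 'v \<Rightarrow> nat" where
  "incidence B n u v = card {e \<in> edges B n. src B e = u \<and> rng B e = v}"

definition simple_diagram :: "('v, 'e) bratteli \<Rightarrow> bool" where
  "simple_diagram B \<longleftrightarrow>
    (\<forall>m\<ge>1. \<exists>n>m. \<forall>u \<in> verts B m. \<forall>v \<in> verts B n. \<exists>p :: nat \<Rightarrow> 'e.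
      (\<forall>k \<in> {m<..n}. p k \<in> edges B k) \<and> (\<forall>k \<in> {m<..<n}. rng B (p k) = src B (p (Suc k))) \<and>
      src B (p (Suc m)) = u \<and> rng B (p n) = v)"

definition finite_rank :: "('v, 'e) bratteli \<Rightarrow> bool" where
  "finite_rank B \<longleftrightarrow> (\<exists>K. \<forall>n. card (verts B n) \<le> K)"

(* An infinite path is a sequence (x n) for n >= 1; product_topology makes its points
   undefined at 0.  The open sets are the unions of cylinders, as the edge levels are discrete. *)
definition path_space :: "('v, 'e) bratteli \<Rightarrow> (nat \<Rightarrow> 'e) topology" where
  "path_space B =
    subtopology (product_topology (\<lambda>n. discrete_topology (edges B n)) {1..})
      {x. \<forall>n\<ge>1. rng B (x n) = src B (x (Suc n))}"

definition strictly_below :: "('v, 'e) bratteli \<Rightarrow> 'e \<Rightarrow> 'e \<Rightarrow> bool" where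
  "strictly_below B e f \<longleftrightarrow> (e, f) \<in> edge_order B \<and> e \<noteq> f"

definition max_edge :: "('v, 'e) bratteli \<Rightarrow> 'e \<Rightarrow> bool" where
  "max_edge B e \<longleftrightarrow> \<not> (\<exists>f. strictly_below B e f)"

definition min_edge :: "('v, 'e) bratteli \<Rightarrow> 'e \<Rightarrow> bool" where
  "min_edge B e \<longleftrightarrow> \<not> (\<exists>f. strictly_below B f e)"

definition succ_edge :: "('v, 'e) bratteli \<Rightarrow> 'e \<Rightarrow> 'e" where
  "succ_edge B e =
    (THE f. strictly_below B e f \<and> \<not> (\<exists>g. strictly_below B e g \<and> strictly_below B g f))"

definition max_path :: "('v, 'e) bratteli \<Rightarrow> (nat \<Rightarrow> 'e) \<Rightarrow> bool" where
  "max_path B x \<longleftrightarrow> x \<in> topspace (path_space B) \<and> (\<forall>n\<ge>1. max_edge B (x n))"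

definition min_path :: "('v, 'e) bratteli \<Rightarrow> (nat \<Rightarrow> 'e) \<Rightarrow> bool" where
  "min_path B x \<longleftrightarrow> x \<in> topspace (path_space B) \<and> (\<forall>n\<ge>1. min_edge B (x n))"

definition properly_ordered :: "('v, 'e) bratteli \<Rightarrow> bool" where
  "properly_ordered B \<longleftrightarrow>
    ordered_bratteli_diagram B \<and> (\<exists>!x. max_path B x) \<and> (\<exists>!x. min_path B x)"

(* As y is an infinite path, its edges y 1, ..., y (n - 1) form a path from the root to the
   source of y n; being all minimal they are the minimal such path. *)
definition vershik_map :: "('v, 'e) bratteli \<Rightarrow> (nat \<Rightarrow> 'e) \<Rightarrow> (nat \<Rightarrow> 'e)" where
  "vershik_map B x =
    (if max_path B x then THE y. min_path B y
     else let n = (LEAST n. n \<ge> 1 \<and> \<not> max_edge B (x n)) in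
       THE y. y \<in> topspace (path_space B) \<and>
         (\<forall>k \<in> {1..<n}. min_edge B (y k)) \<and>
         y n = succ_edge B (x n) \<and>
         (\<forall>k>n. y k = x k))"

definition conjugate_systems ::
    "'x topology \<Rightarrow> ('x \<Rightarrow> 'x) \<Rightarrow> 'y topology \<Rightarrow> ('y \<Rightarrow> 'y) \<Rightarrow> bool" where
  "conjugate_systems X T Y S \<longleftrightarrow>
    (\<exists>\<phi>. homeomorphic_map X Y \<phi> \<and> (\<forall>x \<in> topspace X. \<phi> (T x) = S (\<phi> x)))"

definition bratteli_vershik_representation ::
    "('v, 'e) bratteli \<Rightarrow> 'x topology \<Rightarrow> ('x \<Rightarrow> 'x) \<Rightarrow> bool" where
  "bratteli_vershik_representation B X T \<longleftrightarrow>
    properly_ordered B \<and> simple_diagram B \<and>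
    conjugate_systems X T (path_space B) (vershik_map B)"

(* The labelling vtx n identifies {1, 2, 3} with the n-th vertex level; the levels
   themselves are pairwise disjoint.  M_1 is (1, 1, 1), and M_n is the matrix M n for n >= 2. *)
definition has_incidence_matrices ::
    "('v, 'e) bratteli \<Rightarrow> (nat \<Rightarrow> 3 \<Rightarrow> 'v) \<Rightarrow> (nat \<Rightarrow> real^3^3) \<Rightarrow> bool" where
  "has_incidence_matrices B vtx M \<longleftrightarrow>
    (\<forall>n\<ge>1. bij_betw (vtx n) UNIV (verts B n)) \<and>
    (\<forall>u \<in> verts B 0. \<forall>i. incidence B 1 u (vtx 1 i) = 1) \<and>
    (\<forall>n\<ge>2. \<forall>i j. real (incidence B n (vtx (n - 1) i) (vtx n j)) = M n $ i $ j)"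

end

theory Submission
  imports Defs
begin

text \<open>
  An invariant measure gives the same mass \<open>m k i\<close> to all cylinders ending at the vertex \<open>i\<close> of
  level \<open>k + 1\<close>. The vectors \<open>m k\<close> are nonnegative, satisfy \<open>m k = A\<^sub>k m (k + 1)\<close> for the \<open>k\<close>-th
  matrix \<open>A\<^sub>k\<close>, and determine the measure. As \<open>A\<close> for the letter 3 maps nonnegative nonzero vectors
  into \<open>D\<close>, all \<open>m k\<close> lie in \<open>D\<close>. Multiplying a row vector by \<open>A\<^sub>k\<close> does not increase the supremum
  norm when the product is orthogonal to a vector of \<open>D\<close>; so the hypothesis makes the norms of
  \<open>z P\<^sub>k\<close>, with \<open>P\<^sub>k\<close> the product of the first \<open>k\<close> matrices, summable over \<open>k\<close> for every \<open>z\<close>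
  orthogonal to \<open>\<nu> = m 0\<close>.

  If \<open>m'\<close> is another solution, then \<open>z \<bullet> m' 0\<close> is the product of \<open>z P\<^sub>k\<close> with the bounded vector
  \<open>m' k\<close>, hence 0: this gives unique ergodicity. If \<open>z\<close> is integral, the \<open>z P\<^sub>k\<close> are integral and tend
  to 0, hence \<open>z = 0\<close>: this gives rational independence. As the matrices are unimodular, all masses lie
  in the group generated by the entries of \<open>\<nu>\<close>, and so do the integrals of integer-valued functions.
  For \<open>\<alpha>\<close> in this group the distances of \<open>\<alpha>\<close> times the heights to the integers are summable, so
  \<open>exp (2 \<pi> i \<alpha> r)\<close>, with \<open>r\<close> the rank of the first \<open>k\<close> edges, converges uniformly to an
  eigenfunction. Finally, an eigenfunction for \<open>\<alpha>\<close> lifts to a real function \<open>g\<close> for which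
  \<open>\<alpha> + g - g \<circ> T\<close> is integer-valued, and the integral of this function is \<open>\<alpha>\<close>.
\<close>

section \<open>The Vershik order on paths\<close>

definition edges_below :: "('v, 'e) bratteli \<Rightarrow> 'e \<Rightarrow> 'e set" where
  "edges_below B e = {f. strictly_below B f e}"

definition edges_into :: "('v, 'e) bratteli \<Rightarrow> nat \<Rightarrow> 'v \<Rightarrow> 'e set" where
  "edges_into B n v = {e \<in> edges B n. rng B e = v}"

text \<open>The number of paths from the root to \<open>v\<close>; the value 1 at level 0 is meant
  for the root, the only vertex there.\<close>

fun height :: "('v, 'e) bratteli \<Rightarrow> nat \<Rightarrow> 'v \<Rightarrow> nat" where
  "height B 0 v = 1"
| "height B (Suc n) v = (\<Sum>e\<in>edges_into B (Suc n) v. height B n (src B e))"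

text \<open>\<open>path_rank B n x\<close> counts the paths from the root that end at the same vertex of level \<open>n\<close>
  as \<open>(x 1, \<dots>, x n)\<close> and precede it in the Vershik order.\<close>

fun path_rank :: "('v, 'e) bratteli \<Rightarrow> nat \<Rightarrow> (nat \<Rightarrow> 'e) \<Rightarrow> nat" where
  "path_rank B 0 x = 0"
| "path_rank B (Suc n) x =
    path_rank B n x + (\<Sum>e\<in>edges_below B (x (Suc n)). height B n (src B e))"

abbreviation paths :: "('v, 'e) bratteli \<Rightarrow> (nat \<Rightarrow> 'e) set" where
  "paths B \<equiv> topspace (path_space B)"

lemma paths_iff:
  "x \<in> paths B \<longleftrightarrow>
    x \<in> extensional {1..} \<and> (\<forall>n\<ge>1. x n \<in> edges B n \<and> rng B (x n) = src B (x (Suc n)))"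
  unfolding path_space_def by (auto simp: PiE_iff)

lemma ex_minimal_nat:
  fixes f :: "'a \<Rightarrow> nat"
  assumes "S \<noteq> {}"
  obtains a where "a \<in> S" "\<And>b. b \<in> S \<Longrightarrow> f a \<le> f b"
  using assms ex_has_least_nat[of "\<lambda>a. a \<in> S" _ f] by (metis all_not_in_conv)

section \<open>Edges with a common range and their order\<close>

locale ordered_bratteli =
  fixes B :: "('v, 'e) bratteli"
  assumes ordered: "ordered_bratteli_diagram B"
begin

lemma diagram: "bratteli_diagram B"
  using ordered unfolding ordered_bratteli_diagram_def by blast

lemma finite_edges: "finite (edges B (Suc n))"
  using diagram unfolding bratteli_diagram_def by simp

lemma src_edge: "e \<in> edges B (Suc n) \<Longrightarrow> src B e \<in> verts B n"
  and rng_edge: "e \<in> edges B (Suc n) \<Longrightarrow> rng B e \<in> verts B (Suc n)"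
proof -
  have "\<forall>n\<ge>1. \<forall>e \<in> edges B n. src B e \<in> verts B (n - 1) \<and> rng B e \<in> verts B n"
    using diagram unfolding bratteli_diagram_def by blast
  from spec[OF this, of "Suc n"] show "e \<in> edges B (Suc n) \<Longrightarrow> src B e \<in> verts B n"
    "e \<in> edges B (Suc n) \<Longrightarrow> rng B e \<in> verts B (Suc n)" by auto
qed

lemma edge_into_ex: "v \<in> verts B (Suc n) \<Longrightarrow> \<exists>e \<in> edges B (Suc n). rng B e = v"
  using diagram unfolding bratteli_diagram_def by auto

lemma verts_disjoint: "m \<noteq> n \<Longrightarrow> verts B m \<inter> verts B n = {}"
  using diagram unfolding bratteli_diagram_def by blast

lemma finite_verts: "finite (verts B n)"
  using diagram unfolding bratteli_diagram_def by blast

lemma ex_root: "\<exists>v0. verts B 0 = {v0}"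
  using diagram unfolding bratteli_diagram_def by blast

lemma edges_all_edges: "e \<in> edges B (Suc n) \<Longrightarrow> e \<in> all_edges B"
  unfolding all_edges_def by auto

text \<open>The vertex levels are pairwise disjoint, so the range of an edge determines its level.
  Hence \<open>edge_order\<close>, given on all edges at once, respects the levels.\<close>

lemma all_edges_level:
  assumes "f \<in> all_edges B" "rng B f \<in> verts B (Suc n)"
  shows "f \<in> edges B (Suc n)"
proof -
  obtain m where m: "m \<ge> 1" "f \<in> edges B m" using assms(1) unfolding all_edges_def by auto
  then have "rng B f \<in> verts B m" using rng_edge[of f "m - 1"] by simp
  then have "m = Suc n" using verts_disjoint[of m "Suc n"] assms(2) by blast
  then show ?thesis using m by simp
qed

lemma below_edge:
  assumes "strictly_below B e f"
  shows "e \<in> all_edges B" "f \<in> all_edges B" "rng B e = rng B f"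
proof -
  have "edge_order B \<subseteq> all_edges B \<times> all_edges B"
    using ordered unfolding ordered_bratteli_diagram_def partial_order_on_def preorder_on_def
    by (auto simp: refl_on_def)
  then show 1: "e \<in> all_edges B" "f \<in> all_edges B"
    using assms unfolding strictly_below_def by auto
  then show "rng B e = rng B f"
    using ordered assms unfolding ordered_bratteli_diagram_def strictly_below_def by blast
qed

lemma below_same_level:
  assumes "strictly_below B e f"
  shows "e \<in> edges B (Suc n) \<longleftrightarrow> f \<in> edges B (Suc n)"
  using below_edge[OF assms] all_edges_level rng_edge by metis

lemma below_irrefl: "\<not> strictly_below B e e"
  unfolding strictly_below_def by simp

lemma below_trans: "strictly_below B e f \<Longrightarrow> strictly_below B f g \<Longrightarrow> strictly_below B e g"
  using ordered
  unfolding ordered_bratteli_diagram_def partial_order_on_def preorder_on_def strictly_below_def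
  by (metis antisymD transD)

lemma below_total:
  assumes "e \<in> edges B (Suc n)" "f \<in> edges B (Suc n)" "rng B e = rng B f"
  shows "e = f \<or> strictly_below B e f \<or> strictly_below B f e"
  using assms ordered edges_all_edges
  unfolding ordered_bratteli_diagram_def strictly_below_def by metis

lemma edges_below_subset:
  assumes "e \<in> edges B (Suc n)"
  shows "edges_below B e \<subseteq> edges_into B (Suc n) (rng B e) - {e}"
  using assms below_same_level below_edge(3) below_irrefl
  unfolding edges_below_def edges_into_def by blast

lemma finite_edges_into: "finite (edges_into B (Suc n) v)"
  unfolding edges_into_def using finite_edges by simp

lemma finite_edges_below: "e \<in> edges B (Suc n) \<Longrightarrow> finite (edges_below B e)"
  by (meson edges_below_subset finite_Diff finite_edges_into finite_subset)

lemma sum_insert_edges_below: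
  assumes "e \<in> edges B (Suc n)"
  shows "(\<Sum>f\<in>insert e (edges_below B e). g f) = g e + (\<Sum>f\<in>edges_below B e. g f)"
  using finite_edges_below[OF assms] below_irrefl
  by (subst sum.insert) (auto simp: edges_below_def)

lemma edges_below_max:
  assumes "e \<in> edges B (Suc n)" "max_edge B e"
  shows "insert e (edges_below B e) = edges_into B (Suc n) (rng B e)"
proof
  show "insert e (edges_below B e) \<subseteq> edges_into B (Suc n) (rng B e)"
    using assms(1) edges_below_subset[OF assms(1)] unfolding edges_into_def by auto
  show "edges_into B (Suc n) (rng B e) \<subseteq> insert e (edges_below B e)"
  proof
    fix f assume "f \<in> edges_into B (Suc n) (rng B e)"
    then show "f \<in> insert e (edges_below B e)"
      using below_total[OF assms(1), of f] assms(2)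
      unfolding edges_into_def max_edge_def edges_below_def by auto
  qed
qed

lemma edges_below_min: "min_edge B e \<Longrightarrow> edges_below B e = {}"
  unfolding min_edge_def edges_below_def by auto

text \<open>An edge into \<open>v\<close> with the fewest edges below it is minimal, since a smaller
  edge would have strictly fewer. Uniqueness comes from the comparability of edges with a common
  range.\<close>

lemma ex_min_edge:
  assumes "v \<in> verts B (Suc n)"
  shows "\<exists>!e. e \<in> edges B (Suc n) \<and> rng B e = v \<and> min_edge B e"
proof -
  obtain e0 where e0: "e0 \<in> edges B (Suc n)" "rng B e0 = v" using edge_into_ex[OF assms] by blast
  let ?S = "edges_into B (Suc n) v"
  obtain e where e: "e \<in> ?S" "\<And>f. f \<in> ?S \<Longrightarrow> card (edges_below B e) \<le> card (edges_below B f)"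
    using ex_minimal_nat[of ?S "\<lambda>e. card (edges_below B e)"] e0
    unfolding edges_into_def by blast
  have "min_edge B e"
    unfolding min_edge_def
  proof
    assume "\<exists>f. strictly_below B f e"
    then obtain f where f: "strictly_below B f e" by blast
    then have "edges_below B f \<subset> edges_below B e"
      unfolding edges_below_def using below_trans below_irrefl by blast
    moreover have "f \<in> ?S"
      using f e(1) below_edge(3)[OF f] below_same_level[OF f] unfolding edges_into_def by auto
    ultimately show False
      using e psubset_card_mono[OF finite_edges_below, of e n] unfolding edges_into_def
      by (metis (mono_tags, lifting) leD mem_Collect_eq)
  qed
  moreover have "f = e" if "f \<in> edges B (Suc n)" "rng B f = v" "min_edge B f" for f
    using below_total[OF that(1), of e] that \<open>min_edge B e\<close> e(1)
    unfolding edges_into_def min_edge_def by auto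
  ultimately show ?thesis using e(1) unfolding edges_into_def by blast
qed

text \<open>The successor is the edge above \<open>e\<close> with the fewest edges below it. The
  equation for \<open>edges_below\<close> is the point: it makes the rank grow by exactly one under
  the Vershik map.\<close>

lemma succ_edge:
  assumes "e \<in> edges B (Suc n)" "\<not> max_edge B e"
  shows "succ_edge B e \<in> edges B (Suc n)" "rng B (succ_edge B e) = rng B e"
    "edges_below B (succ_edge B e) = insert e (edges_below B e)" "\<not> min_edge B (succ_edge B e)"
proof -
  let ?S = "{f. strictly_below B e f}"
  let ?P = "\<lambda>f. strictly_below B e f \<and> \<not> (\<exists>g. strictly_below B e g \<and> strictly_below B g f)"
  have ne: "?S \<noteq> {}" using assms(2) unfolding max_edge_def by auto
  obtain f where f: "f \<in> ?S" "\<And>g. g \<in> ?S \<Longrightarrow> card (edges_below B f) \<le> card (edges_below B g)"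
    using ex_minimal_nat[OF ne, of "\<lambda>f. card (edges_below B f)"] by blast
  have lev: "f \<in> edges B (Suc n)" using f(1) below_same_level[of e f n] assms(1) by simp
  have P: "?P f"
  proof (intro conjI notI)
    show "strictly_below B e f" using f by simp
    assume "\<exists>g. strictly_below B e g \<and> strictly_below B g f"
    then obtain g where g: "strictly_below B e g" "strictly_below B g f" by blast
    then have "edges_below B g \<subset> edges_below B f"
      unfolding edges_below_def using below_trans below_irrefl by blast
    then show False
      using f(2)[of g] g psubset_card_mono[OF finite_edges_below[OF lev], of "edges_below B g"] by simp
  qed
  have uniq: "g = f" if "?P g" for g
  proof -
    have "g \<in> edges B (Suc n)" "rng B f = rng B g"
      using that P below_same_level[of e g n] assms(1) below_edge(3)[of e f] below_edge(3)[of e g] by auto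
    then show ?thesis using below_total[OF lev, of g] that P by blast
  qed
  have eq: "succ_edge B e = f"
    unfolding succ_edge_def using P uniq by (rule the_equality)
  show "succ_edge B e \<in> edges B (Suc n)" "rng B (succ_edge B e) = rng B e"
    "\<not> min_edge B (succ_edge B e)"
    unfolding eq min_edge_def using lev P below_edge(3)[of e f] by auto
  show "edges_below B (succ_edge B e) = insert e (edges_below B e)"
    unfolding eq edges_below_def
  proof (intro set_eqI iffI)
    fix g assume "g \<in> {fa. strictly_below B fa f}"
    then have g: "strictly_below B g f" by simp
    then have "g \<in> edges B (Suc n)" "rng B g = rng B e"
      using lev P below_same_level[of g f n] below_edge(3)[of _ f] by auto
    then show "g \<in> insert e {f. strictly_below B f e}"
      using below_total[OF _ assms(1), of g] P g by auto
  next
    fix g assume "g \<in> insert e {f. strictly_below B f e}"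
    then show "g \<in> {fa. strictly_below B fa f}" using P below_trans by blast
  qed
qed

section \<open>Ranks and heights of finite paths\<close>

lemma path_edge: "x \<in> paths B \<Longrightarrow> x (Suc n) \<in> edges B (Suc n)"
  and path_step: "x \<in> paths B \<Longrightarrow> rng B (x (Suc n)) = src B (x (Suc (Suc n)))"
  by (auto simp: paths_iff)

lemma path_vertex: "x \<in> paths B \<Longrightarrow> src B (x (Suc n)) \<in> verts B n"
  using path_edge src_edge by blast

text \<open>The sum over \<open>edges_below\<close> omits the edge of the path itself; its share in
  the height exceeds the rank of the shorter path by induction.\<close>

lemma path_rank_less_height:
  assumes "x \<in> paths B"
  shows "path_rank B n x < height B n (src B (x (Suc n)))"
proof (induction n)
  case (Suc n)
  let ?e = "x (Suc n)"
  have e: "?e \<in> edges B (Suc n)" using assms path_edge by blast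
  have "path_rank B (Suc n) x <
      height B n (src B ?e) + (\<Sum>e\<in>edges_below B ?e. height B n (src B e))"
    using Suc by simp
  also have "\<dots> = (\<Sum>e\<in>insert ?e (edges_below B ?e). height B n (src B e))"
    by (simp add: sum_insert_edges_below[OF e])
  also have "\<dots> \<le> (\<Sum>e\<in>edges_into B (Suc n) (rng B ?e). height B n (src B e))"
    by (rule sum_mono2[OF finite_edges_into])
       (use edges_below_subset[OF e] e in \<open>auto simp: edges_into_def\<close>)
  finally show ?case using path_step[OF assms] by simp
qed simp

text \<open>For maximal edges the estimate of \<open>path_rank_less_height\<close> loses nothing
  beyond the 1: the path is the last one to its end vertex.\<close>

lemma path_rank_max:
  assumes "x \<in> paths B" "\<And>k. k < n \<Longrightarrow> max_edge B (x (Suc k))"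
  shows "Suc (path_rank B n x) = height B n (src B (x (Suc n)))"
  using assms(2)
proof (induction n)
  case (Suc n)
  let ?e = "x (Suc n)"
  have e: "?e \<in> edges B (Suc n)" using assms path_edge by blast
  have "Suc (path_rank B (Suc n) x) =
      height B n (src B ?e) + (\<Sum>e\<in>edges_below B ?e. height B n (src B e))"
    using Suc by simp
  also have "\<dots> = (\<Sum>e\<in>insert ?e (edges_below B ?e). height B n (src B e))"
    by (simp add: sum_insert_edges_below[OF e])
  also have "insert ?e (edges_below B ?e) = edges_into B (Suc n) (rng B ?e)"
    using edges_below_max[OF e] Suc by simp
  finally show ?case using path_step[OF assms(1)] by simp
qed simp

lemma path_rank_min:
  assumes "\<And>k. k < n \<Longrightarrow> min_edge B (x (Suc k))"
  shows "path_rank B n x = 0"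
  using assms by (induction n) (auto simp: edges_below_min)

lemma path_rank_cong: "(\<And>k. k < n \<Longrightarrow> x (Suc k) = y (Suc k)) \<Longrightarrow> path_rank B n x = path_rank B n y"
  by (induction n) auto

text \<open>Ranks behave like a positional number system: by \<open>path_rank_less_height\<close>, a
  smaller edge at the highest level outweighs all lower edges. So the last edges coincide, and
  induction descends.\<close>

lemma path_rank_inj:
  assumes "x \<in> paths B" "y \<in> paths B"
  shows "src B (x (Suc n)) = src B (y (Suc n)) \<Longrightarrow> path_rank B n x = path_rank B n y \<Longrightarrow>
    k < n \<Longrightarrow> x (Suc k) = y (Suc k)"
proof (induction n arbitrary: k)
  case (Suc n)
  have less: "path_rank B (Suc n) x < path_rank B (Suc n) y"
    if xy: "x \<in> paths B" "y \<in> paths B" and b: "strictly_below B (x (Suc n)) (y (Suc n))" for x y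
  proof -
    have e: "x (Suc n) \<in> edges B (Suc n)" "y (Suc n) \<in> edges B (Suc n)" using xy path_edge by auto
    have "path_rank B (Suc n) x <
      height B n (src B (x (Suc n))) + (\<Sum>e\<in>edges_below B (x (Suc n)). height B n (src B e))"
      using path_rank_less_height[OF xy(1), of n] by simp
    also have "\<dots> = (\<Sum>e\<in>insert (x (Suc n)) (edges_below B (x (Suc n))). height B n (src B e))"
      by (simp add: sum_insert_edges_below[OF e(1)])
    also have "\<dots> \<le> (\<Sum>e\<in>edges_below B (y (Suc n)). height B n (src B e))"
      by (rule sum_mono2[OF finite_edges_below[OF e(2)]])
        (use b below_trans in \<open>auto simp: edges_below_def\<close>)
    finally show ?thesis by simp
  qed
  have eq: "x (Suc n) = y (Suc n)"
    using below_total[OF path_edge[OF assms(1)] path_edge[OF assms(2)], of n]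
      path_step[OF assms(1), of n] path_step[OF assms(2), of n] Suc.prems(1,2)
      less[OF assms] less[OF assms(2,1)] by auto
  then show ?case using Suc by (auto simp: less_Suc_eq)
qed simp

section \<open>The Vershik map and its action on ranks\<close>

lemma ex_min_initial:
  assumes "v \<in> verts B N"
  shows "\<exists>p. \<forall>k<N. p (Suc k) \<in> edges B (Suc k) \<and> min_edge B (p (Suc k)) \<and>
    rng B (p (Suc k)) = (if Suc k = N then v else src B (p (Suc (Suc k))))"
  using assms
proof (induction N arbitrary: v)
  case (Suc N)
  obtain e where e: "e \<in> edges B (Suc N)" "rng B e = v" "min_edge B e"
    using ex_min_edge[OF Suc.prems] by blast
  obtain p where "\<forall>k<N. p (Suc k) \<in> edges B (Suc k) \<and> min_edge B (p (Suc k)) \<and>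
    rng B (p (Suc k)) = (if Suc k = N then src B e else src B (p (Suc (Suc k))))"
    using Suc.IH[OF src_edge[OF e(1)]] by blast
  then show ?case using e by (intro exI[of _ "p(Suc N := e)"]) (auto simp: less_Suc_eq)
qed simp

text \<open>The description operator in \<open>vershik_map\<close> is resolved by a witness
  \<open>y\<close> and by uniqueness: the edge at level \<open>Suc N\<close> fixes the vertex below
  it, and each vertex has exactly one minimal incoming edge.\<close>

lemma vershik_map_nonmax:
  assumes x: "x \<in> paths B" and nonmax: "\<not> max_edge B (x (Suc N))"
    and max: "\<And>k. k < N \<Longrightarrow> max_edge B (x (Suc k))"
  shows "vershik_map B x \<in> paths B" "vershik_map B x (Suc N) = succ_edge B (x (Suc N))"
    "k < N \<Longrightarrow> min_edge B (vershik_map B x (Suc k))" "k > N \<Longrightarrow> vershik_map B x (Suc k) = x (Suc k)"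
proof -
  have "\<not> max_path B x" using nonmax unfolding max_path_def by auto
  moreover have "(LEAST n. n \<ge> 1 \<and> \<not> max_edge B (x n)) = Suc N"
  proof (rule Least_equality)
    show "1 \<le> y \<and> \<not> max_edge B (x y) \<Longrightarrow> Suc N \<le> y" for y
      using max[of "y - 1"] by (cases y) (auto simp: not_less[symmetric])
  qed (use nonmax in auto)
  moreover define P where "P = (\<lambda>y. y \<in> paths B \<and> (\<forall>k \<in> {1..<Suc N}. min_edge B (y k)) \<and>
         y (Suc N) = succ_edge B (x (Suc N)) \<and> (\<forall>k>Suc N. y k = x k))"
  ultimately have V: "vershik_map B x = (THE y. P y)"
    unfolding vershik_map_def P_def by simp
  note s = succ_edge[OF path_edge[OF x] nonmax]
  obtain p where p: "\<And>k. k<N \<Longrightarrow> p (Suc k) \<in> edges B (Suc k) \<and> min_edge B (p (Suc k)) \<and>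
    rng B (p (Suc k)) = (if Suc k = N then src B (succ_edge B (x (Suc N))) else src B (p (Suc (Suc k))))"
    using ex_min_initial[OF src_edge[OF s(1)]] by blast
  \<comment> \<open>Points of \<open>path_space\<close> are \<open>undefined\<close> at 0, so the
    witness has to be as well.\<close>
  define y where "y = (\<lambda>k. if k = 0 then undefined else if k \<le> N then p k
     else if k = Suc N then succ_edge B (x (Suc N)) else x k)"
  have ypath: "y \<in> paths B"
    unfolding paths_iff
  proof (intro conjI allI impI)
    show "y \<in> extensional {1..}" unfolding y_def extensional_def by auto
    fix n :: nat assume n: "1 \<le> n"
    then obtain k where k: "n = Suc k" by (cases n) auto
    show "y n \<in> edges B n"
      unfolding y_def using p[of k] k s(1) path_edge[OF x] by auto
    show "rng B (y n) = src B (y (Suc n))"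
      unfolding y_def using p[of k] k s(2) path_step[OF x] by auto
  qed
  have Py: "P y"
    unfolding P_def
  proof (intro conjI ballI allI impI)
    show "min_edge B (y k)" if "k \<in> {1..<Suc N}" for k
      using that p[of "k - 1"] unfolding y_def by auto
  qed (use ypath in \<open>auto simp: y_def\<close>)
  have uniq: "z = y" if z: "P z" for z
  proof
    have zp: "z \<in> paths B" using z unfolding P_def by blast
    have large: "z (Suc k) = y (Suc k)" if "k \<ge> N" for k
      using z Py that unfolding P_def by (cases "k = N") auto
    \<comment> \<open>Descent from level \<open>Suc N\<close>; for \<open>i > N\<close> truncated
      subtraction repeats the index 0.\<close>
    have small: "z (Suc (N - i)) = y (Suc (N - i))" for i
    proof (induction i)
      case (Suc i)
      show ?case
      proof (cases "i < N")
        case True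
        let ?k = "N - Suc i"
        have k: "Suc ?k = N - i" using True by simp
        have "rng B (z (Suc ?k)) = rng B (y (Suc ?k))"
          using path_step[OF zp, of ?k] path_step[OF ypath, of ?k] Suc k by simp
        moreover have "min_edge B (z (Suc ?k))" "min_edge B (y (Suc ?k))"
          using z Py True unfolding P_def by auto
        ultimately show ?thesis
          using ex_min_edge[OF rng_edge[OF path_edge[OF zp, of ?k]]] path_edge[OF zp, of ?k]
            path_edge[OF ypath, of ?k] by metis
      next
        case False
        then show ?thesis using Suc by simp
      qed
    qed (use large in simp)
    show "z k = y k" for k
    proof (cases k)
      case 0
      then show ?thesis using zp ypath unfolding paths_iff extensional_def by auto
    next
      case (Suc j)
      then show ?thesis using large[of j] small[of "N - j"] by (cases "j \<ge> N") auto
    qed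
  qed
  have "P (vershik_map B x)" unfolding V using Py uniq by (rule theI)
  then show "vershik_map B x \<in> paths B" "vershik_map B x (Suc N) = succ_edge B (x (Suc N))"
    "k < N \<Longrightarrow> min_edge B (vershik_map B x (Suc k))" "k > N \<Longrightarrow> vershik_map B x (Suc k) = x (Suc k)"
    unfolding P_def by auto
qed

lemma ex_first_nonmax:
  assumes "\<not> max_edge B (x (Suc k))"
  obtains N where "N \<le> k" "\<not> max_edge B (x (Suc N))" "\<And>j. j < N \<Longrightarrow> max_edge B (x (Suc j))"
proof (rule that)
  let ?N = "LEAST k. \<not> max_edge B (x (Suc k))"
  show "?N \<le> k" "\<not> max_edge B (x (Suc ?N))"
    using Least_le[of "\<lambda>k. \<not> max_edge B (x (Suc k))", OF assms]
      LeastI[of "\<lambda>k. \<not> max_edge B (x (Suc k))", OF assms] by auto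
  show "j < ?N \<Longrightarrow> max_edge B (x (Suc j))" for j
    using not_less_Least[of j "\<lambda>k. \<not> max_edge B (x (Suc k))"] by blast
qed

lemma nonmax_path:
  assumes "x \<in> paths B" "\<not> max_path B x"
  obtains N where "\<not> max_edge B (x (Suc N))" "\<And>j. j < N \<Longrightarrow> max_edge B (x (Suc j))"
proof -
  obtain m where m: "m \<ge> 1" "\<not> max_edge B (x m)" using assms unfolding max_path_def by blast
  then have "\<not> max_edge B (x (Suc (m - 1)))" by simp
  then show thesis using ex_first_nonmax[of x "m - 1"] that by blast
qed

text \<open>At the first non-maximal edge, the successor brings in the full height of the old
  source. By \<open>path_rank_max\<close> this is one more than the rank of the maximal edges below,
  which is reset to 0; higher edges do not change.\<close>

lemma path_rank_vershik:
  assumes x: "x \<in> paths B" and k: "\<not> max_edge B (x (Suc k))" "k < n"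
  shows "path_rank B n (vershik_map B x) = Suc (path_rank B n x)"
    "src B (vershik_map B x (Suc n)) = src B (x (Suc n))"
proof -
  obtain N where N: "N \<le> k" "\<not> max_edge B (x (Suc N))" "\<And>j. j < N \<Longrightarrow> max_edge B (x (Suc j))"
    using ex_first_nonmax[of x k] k by blast
  let ?y = "vershik_map B x"
  note V = vershik_map_nonmax[OF x N(2,3), simplified]
  note s = succ_edge[OF path_edge[OF x] N(2)]
  have "path_rank B (Suc N) ?y = (\<Sum>e\<in>insert (x (Suc N)) (edges_below B (x (Suc N))). height B N (src B e))"
    using path_rank_min[of N ?y] V s by simp
  also have "\<dots> = height B N (src B (x (Suc N))) + (\<Sum>e\<in>edges_below B (x (Suc N)). height B N (src B e))"
    by (simp add: sum_insert_edges_below[OF path_edge[OF x]])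
  also have "\<dots> = Suc (path_rank B (Suc N) x)"
    using path_rank_max[OF x N(3)] by simp
  finally have base: "path_rank B (Suc N) ?y = Suc (path_rank B (Suc N) x)" .
  have "path_rank B (Suc N + i) ?y = Suc (path_rank B (Suc N + i) x)" for i
    by (induction i) (use base V in auto)
  from this[of "n - Suc N"] show "path_rank B n ?y = Suc (path_rank B n x)"
    using N(1) k by simp
  show "src B (?y (Suc n)) = src B (x (Suc n))" using V(4)[of n] N(1) k by simp
qed

lemma height_pos: "v \<in> verts B n \<Longrightarrow> height B n v > 0"
proof (induction n arbitrary: v)
  case (Suc n)
  obtain e where e: "e \<in> edges B (Suc n)" "rng B e = v" using edge_into_ex[OF Suc.prems] by blast
  then have "height B n (src B e) \<le> height B (Suc n) v"
    unfolding height.simps by (intro member_le_sum finite_edges_into) (auto simp: edges_into_def)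
  then show ?case using Suc.IH[OF src_edge[OF e(1)]] by linarith
qed simp

end

locale properly_ordered_bratteli = ordered_bratteli +
  assumes proper: "properly_ordered B"
begin

lemma vershik_map_max:
  assumes "max_path B x"
  shows "min_path B (vershik_map B x)"
  using assms proper theI'[of "min_path B"] unfolding vershik_map_def properly_ordered_def by simp

text \<open>The maximal path goes to the minimal one; any other path has its first non-maximal edge
  beyond level \<open>n\<close>, so its first \<open>n\<close> edges become minimal.\<close>

lemma path_rank_vershik_max:
  assumes x: "x \<in> paths B" and max: "\<And>k. k < n \<Longrightarrow> max_edge B (x (Suc k))"
  shows "path_rank B n (vershik_map B x) = 0"
proof (cases "max_path B x")
  case True
  then show ?thesis using vershik_map_max[OF True] unfolding min_path_def
    by (intro path_rank_min) auto
next
  case False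
  then obtain N where N: "\<not> max_edge B (x (Suc N))" "\<And>j. j < N \<Longrightarrow> max_edge B (x (Suc j))"
    using nonmax_path[OF x] by blast
  then have "n \<le> N" using max by (meson leI)
  then show ?thesis
    using vershik_map_nonmax(3)[OF x N] by (intro path_rank_min) auto
qed

end

section \<open>Products of the matrices\<close>

lemma matB_mult_vec:
  "matB 1 *v x = vector [x $ 1 + x $ 2, x $ 2, x $ 3]"
  "matB 2 *v x = vector [x $ 1 + x $ 2, x $ 1, x $ 3]"
  "matB 3 *v x = vector [x $ 1 + x $ 3, x $ 1, x $ 2]"
  by (simp_all add: matB_def vec_eq_iff forall_3 matrix_vector_mult_def sum_3)

lemma vec_mult_matB:
  "y v* matB 1 = vector [y $ 1, y $ 1 + y $ 2, y $ 3]"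
  "y v* matB 2 = vector [y $ 1 + y $ 2, y $ 1, y $ 3]"
  "y v* matB 3 = vector [y $ 1 + y $ 2, y $ 3, y $ 1]"
  by (simp_all add: matB_def vec_eq_iff forall_3 vector_matrix_mult_def sum_3)

lemma matrix_power_mult_vec: "((**) M ^^ m) (mat 1) *v x = ((*v) M ^^ m) x"
  for M :: "'a::comm_semiring_1^'n^'n"
  by (induction m) (simp_all add: matrix_vector_mul_assoc[symmetric])

lemma vec_mult_matrix_power: "y v* ((**) M ^^ m) (mat 1) = ((\<lambda>y. y v* M) ^^ m) y"
  for M :: "'a::comm_semiring_1^'n^'n"
proof (induction m arbitrary: y)
  case (Suc m)
  have "y v* ((**) M ^^ Suc m) (mat 1) = (y v* M) v* ((**) M ^^ m) (mat 1)"
    by (simp add: vector_matrix_mul_assoc)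
  also have "\<dots> = ((\<lambda>y. y v* M) ^^ Suc m) y"
    unfolding Suc funpow_Suc_right by simp
  finally show ?case .
qed simp

text \<open>Each \<open>matA k\<close> is a power of a single \<open>matB j\<close>, with exponent 1
  or 6; properties are therefore checked on the sparse matrices \<open>matB j\<close>.\<close>

lemma matA_mult_vec:
  assumes "k \<in> {1, 2, 3}"
  obtains j m where "j \<in> {1, 2, 3}" "\<And>x. matA k *v x = ((*v) (matB j) ^^ m) x"
    "\<And>y. y v* matA k = ((\<lambda>y. y v* matB j) ^^ m) y"
proof (cases "k = 3")
  case True
  then show ?thesis
    by (intro that[of 3 6])
      (auto simp: matA_def matrix_power_mult_vec vec_mult_matrix_power)
next
  case False
  then show ?thesis using assms
    by (intro that[of k 1]) (auto simp: matA_def)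
qed

lemma matA_mult_vec_pres:
  assumes "k \<in> {1, 2, 3}" "\<And>j x. j \<in> {1, 2, 3} \<Longrightarrow> P x \<Longrightarrow> P (matB j *v x)" "P x"
  shows "P (matA k *v x)"
proof -
  obtain j m where j: "j \<in> {1, 2, 3}" "\<And>x. matA k *v x = ((*v) (matB j) ^^ m) x"
    using matA_mult_vec[OF assms(1)] by metis
  have "P (((*v) (matB j) ^^ m) x)" by (induction m) (use assms j in auto)
  then show ?thesis using j by simp
qed

lemma matA_mult_vec_refl:
  assumes "k \<in> {1, 2, 3}" "\<And>j x. j \<in> {1, 2, 3} \<Longrightarrow> P (matB j *v x) \<Longrightarrow> P x" "P (matA k *v x)"
  shows "P x"
proof -
  obtain j m where j: "j \<in> {1, 2, 3}" "\<And>x. matA k *v x = ((*v) (matB j) ^^ m) x"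
    using matA_mult_vec[OF assms(1)] by metis
  have "P (((*v) (matB j) ^^ m) x) \<Longrightarrow> P x" by (induction m) (use assms(2) j in auto)
  then show ?thesis using assms(3) j by simp
qed

lemma vec_mult_matA_pres:
  assumes "k \<in> {1, 2, 3}" "\<And>j x. j \<in> {1, 2, 3} \<Longrightarrow> P x \<Longrightarrow> P (x v* matB j)" "P x"
  shows "P (x v* matA k)"
proof -
  obtain j m where j: "j \<in> {1, 2, 3}" "\<And>y. y v* matA k = ((\<lambda>y. y v* matB j) ^^ m) y"
    using matA_mult_vec[OF assms(1)] by metis
  have "P (((\<lambda>y. y v* matB j) ^^ m) x)" by (induction m) (use assms j in auto)
  then show ?thesis using j by simp
qed

section \<open>Invariance of the cone \<open>coneD\<close>\<close>

lemma matB_coneD: "j \<in> {1, 2, 3} \<Longrightarrow> x \<in> coneD \<Longrightarrow> matB j *v x \<in> coneD"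
  unfolding coneD_def by (auto simp: matB_mult_vec[unfolded One_nat_def])

lemma matA_coneD: "k \<in> {1, 2, 3} \<Longrightarrow> x \<in> coneD \<Longrightarrow> matA k *v x \<in> coneD"
  by (rule matA_mult_vec_pres[where P = "\<lambda>x. x \<in> coneD"]) (use matB_coneD in auto)

text \<open>The rows of the sixth power are (6, 3, 4), (4, 2, 3) and (3, 1, 2): positive, and
  strictly decreasing in each column.\<close>

lemma matA_3_coneD:
  assumes "\<And>i. x $ i \<ge> 0" "x \<noteq> 0"
  shows "matA 3 *v x \<in> coneD"
proof -
  have "matA 3 *v x = ((*v) (matB 3) ^^ 6) x"
    unfolding matA_def by (simp add: matrix_power_mult_vec)
  also have "\<dots> = vector [6 * x $ 1 + 3 * x $ 2 + 4 * x $ 3, 4 * x $ 1 + 2 * x $ 2 + 3 * x $ 3,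
      3 * x $ 1 + x $ 2 + 2 * x $ 3]"
  proof -
    have 6: "(f ^^ 6) x = f (f (f (f (f (f x)))))" for f :: "real^3 \<Rightarrow> real^3"
      by (simp add: numeral_eq_Suc)
    show ?thesis unfolding 6 matB_mult_vec by (simp add: vec_eq_iff forall_3)
  qed
  finally show ?thesis
    using assms(1)[of 1] assms(1)[of 2] assms(1)[of 3] assms(2)
    unfolding coneD_def vec_eq_iff forall_3 by auto
qed

section \<open>Row vectors and the supremum norm\<close>

lemma infnorm_le_iff: "infnorm v \<le> b \<longleftrightarrow> (\<forall>i. \<bar>v $ i\<bar> \<le> b)" for v :: "real^'n"
proof -
  have "{\<bar>v $ i\<bar> | i. i \<in> UNIV} = range (\<lambda>i. \<bar>v $ i\<bar>)" by auto
  then show ?thesis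
    unfolding infnorm_cart by (simp add: cSUP_le_iff bdd_above_finite)
qed

text \<open>Only a coordinate \<open>s + t\<close> with \<open>s\<close>, \<open>t\<close> coordinates of \<open>y\<close> could exceed the norm of \<open>y\<close>, and only if
  \<open>s\<close> and \<open>t\<close> have the same sign; then orthogonality to a vector with decreasing coordinates makes the
  third coordinate at least as large.\<close>

lemma vec_mult_matB_infnorm_le:
  assumes "j \<in> {1, 2, 3}" "x \<in> coneD" "(y v* matB j) \<bullet> x = 0"
  shows "infnorm (y v* matB j) \<le> infnorm y"
proof -
  have c: "\<bar>y $ i\<bar> \<le> infnorm y" for i by (rule component_le_infnorm_cart)
  \<comment> \<open>The disjuncts are the orthogonality relations for \<open>j = 2\<close>,
    \<open>j = 3\<close> and \<open>j = 1\<close>, in this order, with \<open>s\<close>,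
    \<open>t\<close>, \<open>u\<close> the coordinates of \<open>y\<close>.\<close>
  have mono: "\<bar>s + t\<bar> \<le> infnorm y"
    if eq: "(s + t) * a + s * b + u * c = 0 \<or> (s + t) * a + u * b + s * c = 0 \<or> s * a + (s + t) * b + u * c = 0"
      and bounds: "\<bar>s\<bar> \<le> infnorm y" "\<bar>t\<bar> \<le> infnorm y" "\<bar>u\<bar> \<le> infnorm y"
      and abc: "a > b" "b > c" "c > 0"
    for s t u a b c :: real
  proof -
    have pos: "s + t \<le> \<bar>u\<bar>"
      if eq': "(s + t) * a + s * b + u * c = 0 \<or> (s + t) * a + u * b + s * c = 0 \<or> s * a + (s + t) * b + u * c = 0"
        and st: "s \<ge> 0" "t \<ge> 0" for s t u
    proof -
      \<comment> \<open>\<open>q\<close> is the coordinate of the cone vector paired with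
        \<open>s + t\<close>, and \<open>d\<close> the one paired with \<open>u\<close>; the
        remaining product is nonnegative and is dropped. In all three cases \<open>s + t\<close>
        stands before \<open>u\<close>, hence \<open>q \<ge> d\<close>.\<close>
      obtain d q where dq: "d > 0" "q \<ge> d" "(s + t) * q \<le> - u * d"
        using eq'
      proof (elim disjE)
        assume "(s + t) * a + s * b + u * c = 0"
        then show thesis using that[of c a] abc st
          mult_nonneg_nonneg[of s b] by linarith
      next
        assume "(s + t) * a + u * b + s * c = 0"
        then show thesis using that[of b a] abc st
          mult_nonneg_nonneg[of s c] by linarith
      next
        assume "s * a + (s + t) * b + u * c = 0"
        then show thesis using that[of c b] abc st
          mult_nonneg_nonneg[of s a] by linarith
      qed
      have "(s + t) * d \<le> (s + t) * q" using dq st by (intro mult_left_mono) auto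
      also have "\<dots> \<le> \<bar>u\<bar> * d" using dq(1,3) mult_right_mono[of "-u" "\<bar>u\<bar>" d] by linarith
      finally show ?thesis using dq(1) by simp
    qed
    consider "s \<ge> 0" "t \<ge> 0" | "s \<le> 0" "t \<le> 0" | "s \<ge> 0" "t \<le> 0" | "s \<le> 0" "t \<ge> 0" by linarith
    then show ?thesis
    proof cases
      case 1
      then show ?thesis using pos[OF eq] bounds by linarith
    next
      case 2
      have "(- s + - t) * a + - s * b + - u * c = 0 \<or> (- s + - t) * a + - u * b + - s * c = 0 \<or>
        - s * a + (- s + - t) * b + - u * c = 0"
        using eq by (auto simp: algebra_simps)
      from pos[OF this] show ?thesis using 2 bounds by linarith
    qed (use bounds in linarith)+
  qed
  have D: "x $ 1 > x $ 2" "x $ 2 > x $ 3" "x $ 3 > 0" using assms(2) unfolding coneD_def by auto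
  have "j = 1 \<or> j = 2 \<or> j = 3" using assms(1) by auto
  then show ?thesis
    using assms(3) c[of 1] c[of 2] c[of 3] mono[OF _ c[of 1] c[of 2] c[of 3] D]
    by (elim disjE) (auto simp: infnorm_le_iff forall_3 vec_mult_matB[unfolded One_nat_def] inner_vec_def sum_3)
qed

text \<open>Induction on the power of \<open>matB j\<close>: if \<open>y v* matB j\<close> is
  orthogonal to \<open>x\<close>, then \<open>y\<close> is orthogonal to \<open>matB j *v x\<close>,
  which is again in the cone. Therefore \<open>x\<close> is generalized.\<close>

lemma vec_mult_matA_infnorm_le:
  assumes "k \<in> {1, 2, 3}" "x \<in> coneD" "(y v* matA k) \<bullet> x = 0"
  shows "infnorm (y v* matA k) \<le> infnorm y"
proof -
  obtain j m where j: "j \<in> {1, 2, 3}" "\<And>y. y v* matA k = ((\<lambda>y. y v* matB j) ^^ m) y"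
    using matA_mult_vec[OF assms(1)] by metis
  have "x \<in> coneD \<Longrightarrow> ((\<lambda>y. y v* matB j) ^^ m) y \<bullet> x = 0 \<Longrightarrow>
      infnorm (((\<lambda>y. y v* matB j) ^^ m) y) \<le> infnorm y" for x
  proof (induction m arbitrary: x)
    case (Suc m)
    let ?y = "((\<lambda>y. y v* matB j) ^^ m) y"
    have "?y \<bullet> (matB j *v x) = 0" using Suc.prems by (simp add: dot_lmul_matrix)
    then have "infnorm ?y \<le> infnorm y" using Suc matB_coneD[OF j(1)] by blast
    moreover have "infnorm (?y v* matB j) \<le> infnorm ?y"
      using vec_mult_matB_infnorm_le[OF j(1)] Suc.prems by simp
    ultimately show ?case by simp
  qed simp
  then show ?thesis using assms j by simp
qed

text \<open>Each \<open>matB j\<close> has an integral inverse whose rows take single coordinates or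
  differences of two, so closure of \<open>G\<close> under differences is all that enters. This is
  unimodularity without determinants.\<close>

lemma matA_mult_vec_subgroup:
  assumes "k \<in> {1, 2, 3}" "\<And>i. (matA k *v x) $ i \<in> G" "\<And>a b. a \<in> G \<Longrightarrow> b \<in> G \<Longrightarrow> a - b \<in> G"
  shows "x $ i \<in> G"
proof -
  have "\<forall>i. x $ i \<in> G"
  proof (rule matA_mult_vec_refl[where P = "\<lambda>x. \<forall>i. x $ i \<in> G", OF assms(1)])
    fix j and x :: "real^3"
    assume j: "j \<in> {1, 2, 3 :: nat}" and x: "\<forall>i. (matB j *v x) $ i \<in> G"
    then show "\<forall>i. x $ i \<in> G"
      using assms(3)[of "x $ 1 + x $ 2" "x $ 2"] assms(3)[of "x $ 1 + x $ 2" "x $ 1"]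
        assms(3)[of "x $ 1 + x $ 3" "x $ 1"]
      by (auto simp: forall_3 matB_mult_vec[unfolded One_nat_def])
  qed (use assms(2) in blast)
  then show ?thesis by blast
qed

lemma matA_mult_vec_inj:
  assumes "k \<in> {1, 2, 3}" "matA k *v x = matA k *v y"
  shows "x = y"
proof -
  have "(x - y) $ i \<in> {0}" for i
    by (rule matA_mult_vec_subgroup[OF assms(1)])
      (use assms(2) in \<open>auto simp: matrix_vector_mult_diff_distrib\<close>)
  then show ?thesis by (simp add: vec_eq_iff)
qed

lemma vec_mult_matA_eq_0:
  assumes "k \<in> {1, 2, 3}" "y v* matA k = 0"
  shows "y = 0"
proof (rule ccontr)
  assume "y \<noteq> 0"
  then have "y v* matA k \<noteq> 0"
    by (rule vec_mult_matA_pres[where P = "\<lambda>y. y \<noteq> 0", OF assms(1), rotated])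
      (auto simp: vec_eq_iff forall_3 vec_mult_matB[unfolded One_nat_def])
  then show False using assms(2) by simp
qed

section \<open>Products over prefixes, and norms relative to a cone\<close>

lemma matA_word_snoc: "matA_word (u @ [k]) = matA_word u ** matA k"
  unfolding matA_word_def by (induction u) (simp_all add: matrix_mul_assoc)

lemma matA_word_prefix_0: "matA_word (prefix_word w 0) = mat 1"
  unfolding matA_word_def prefix_word_def by simp

lemma matA_word_prefix_Suc:
  "matA_word (prefix_word w (Suc n)) = matA_word (prefix_word w n) ** matA (w n)"
  unfolding prefix_word_def by (simp add: matA_word_snoc)

text \<open>Only the finiteness of the bound matters: it makes the suprema in
  \<open>mnorm_at\<close> and \<open>mnorm_on\<close> genuine.\<close>

lemma infnorm_vec_mult_le:
  fixes M :: "real^'n^'m"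
  shows "infnorm (z v* M) \<le> infnorm z * (\<Sum>i\<in>UNIV. \<Sum>j\<in>UNIV. \<bar>M $ i $ j\<bar>)"
  unfolding infnorm_le_iff
proof
  fix j
  have "\<bar>(z v* M) $ j\<bar> \<le> (\<Sum>i\<in>UNIV. \<bar>M $ i $ j * z $ i\<bar>)"
    unfolding vector_matrix_mult_def using sum_abs[of "\<lambda>i. M $ i $ j * z $ i" UNIV]
    by (simp add: mult.commute)
  also have "\<dots> = (\<Sum>i\<in>UNIV. \<bar>M $ i $ j\<bar> * \<bar>z $ i\<bar>)" by (simp add: abs_mult)
  also have "\<dots> \<le> (\<Sum>i\<in>UNIV. (\<Sum>j\<in>UNIV. \<bar>M $ i $ j\<bar>) * infnorm z)"
    by (intro sum_mono mult_mono component_le_infnorm_cart member_le_sum sum_nonneg) auto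
  finally show "\<bar>(z v* M) $ j\<bar> \<le> infnorm z * (\<Sum>i\<in>UNIV. \<Sum>j\<in>UNIV. \<bar>M $ i $ j\<bar>)"
    by (simp add: sum_distrib_left mult.commute)
qed

lemma infnorm_vec_mult_le_mnorm_on:
  assumes x: "x \<in> R" and z: "z \<bullet> x = 0"
  shows "infnorm (z v* M) \<le> infnorm z * mnorm_on M R"
proof (cases "z = 0")
  case True
  then show ?thesis by (simp add: infnorm_0)
next
  case False
  let ?S = "\<lambda>x. {infnorm (z v* M) | z. infnorm z = 1 \<and> z \<bullet> x = 0}"
  let ?C = "\<Sum>i\<in>UNIV. \<Sum>j\<in>UNIV. \<bar>M $ i $ j\<bar>"
  have C: "s \<le> ?C" if s: "s \<in> ?S x" for s x
  proof -
    obtain y where "infnorm y = 1" "s = infnorm (y v* M)" using s by blast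
    then show ?thesis using infnorm_vec_mult_le[of y M] by simp
  qed
  \<comment> \<open>Including \<open>Sup {}\<close> in the bound covers the case that no vector
    \<open>z\<close> is admissible for \<open>x\<close>.\<close>
  have at: "mnorm_at M x \<le> max ?C (Sup {})" for x
  proof (cases "?S x = {}")
    case False
    then show ?thesis
      unfolding mnorm_at_def by (intro order.trans[OF cSup_least[of _ ?C]]) (use C in auto)
  next
    case True
    show ?thesis unfolding mnorm_at_def True by simp
  qed
  let ?z = "(1 / infnorm z) *\<^sub>R z"
  have pos: "infnorm z > 0" using False by (simp add: infnorm_pos_lt)
  have "infnorm (?z v* M) \<in> ?S x"
    using z pos by (auto simp: infnorm_mul intro!: exI[of _ ?z])
  then have "infnorm (?z v* M) \<le> mnorm_at M x"
    unfolding mnorm_at_def by (rule cSup_upper) (rule bdd_aboveI[OF C])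
  also have "\<dots> \<le> mnorm_on M R"
    unfolding mnorm_on_def by (rule cSUP_upper[OF x]) (rule bdd_aboveI2[OF at])
  also have "?z v* M = (1 / infnorm z) *\<^sub>R (z v* M)"
    by (simp add: vec_eq_iff vector_matrix_mult_def sum_divide_distrib)
  finally show ?thesis using pos by (simp add: infnorm_mul field_simps)
qed

section \<open>Solutions of the equations for the masses\<close>

locale summable_word =
  fixes w n :: "nat \<Rightarrow> nat"
  assumes letters: "\<And>k. w k \<in> {1, 2, 3}"
    and infinitely_many_3: "infinite {k. w k = 3}"
    and n_increasing: "strict_mono n"
    and summable_norms:
      "summable (\<lambda>j. (real (n (Suc j)) - real (n j)) *
         mnorm_on (matA_word (prefix_word w (n j))) (coneD_word (prefix_word w (n j))))"
begin

abbreviation "prefix_mat k \<equiv> matA_word (prefix_word w k)"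

text \<open>What invariance imposes on the masses of cylinders, stated without a measure: uniqueness
  and rational independence thereby become linear algebra.\<close>

definition measure_vectors :: "(nat \<Rightarrow> real^3) \<Rightarrow> bool" where
  "measure_vectors m \<longleftrightarrow> (\<forall>k. m k = matA (w k) *v m (Suc k)) \<and> (\<forall>k i. 0 \<le> m k $ i \<and> m k $ i \<le> 1) \<and>
    (\<Sum>i\<in>UNIV. m 0 $ i) = 1"

lemma measure_vectorsD:
  assumes "measure_vectors m"
  shows "m k = matA (w k) *v m (Suc k)" "0 \<le> m k $ i" "m k $ i \<le> 1" "(\<Sum>i\<in>UNIV. m 0 $ i) = 1"
  using assms unfolding measure_vectors_def by blast+

lemma measure_vectors_prefix:
  assumes "measure_vectors m"
  shows "m 0 = prefix_mat k *v m k"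
proof (induction k)
  case (Suc k)
  then show ?case using measure_vectorsD(1)[OF assms, of k]
    by (simp add: matA_word_prefix_Suc matrix_vector_mul_assoc)
qed (simp add: matA_word_prefix_0)

text \<open>A later letter 3 puts some \<open>m l\<close> into the cone, as no \<open>m k\<close>
  vanishes, and the matrices between \<open>k\<close> and \<open>l\<close> preserve the
  cone.\<close>

lemma measure_vectors_coneD:
  assumes m: "measure_vectors m"
  shows "m k \<in> coneD"
proof -
  have nz: "m k \<noteq> 0" for k
  proof
    assume "m k = 0"
    then have "m 0 = 0" using measure_vectors_prefix[OF m, of k] by simp
    then show False using measure_vectorsD(4)[OF m] by simp
  qed
  obtain l where l: "l \<ge> k" "w l = 3"
    using infinitely_many_3 unfolding infinite_nat_iff_unbounded_le by auto
  have "m l \<in> coneD"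
    using matA_3_coneD[of "m (Suc l)"] nz measure_vectorsD(2)[OF m] measure_vectorsD(1)[OF m, of l] l(2)
    by simp
  from l(1) this show ?thesis
  proof (induction rule: inc_induct)
    case (step j)
    then show ?case using matA_coneD[OF letters[of j]] measure_vectorsD(1)[OF m, of j] by simp
  qed simp
qed

text \<open>The norms decrease, so the terms from \<open>n j\<close> up to \<open>n (Suc j)\<close>
  sum to at most their number times the first one. That one is bounded by the norm in the
  hypothesis, since \<open>m 0\<close> lies in
  \<open>coneD_word (prefix_word w (n j))\<close>.\<close>

lemma summable_infnorm_prefix:
  assumes m: "measure_vectors m" and z: "z \<bullet> m 0 = 0"
  shows "summable (\<lambda>k. infnorm (z v* prefix_mat k))"
proof -
  let ?a = "\<lambda>k. infnorm (z v* prefix_mat k)"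
  have "?a (Suc k) \<le> ?a k" for k
  proof -
    have "(z v* prefix_mat (Suc k)) \<bullet> m (Suc k) = 0"
      using z measure_vectors_prefix[OF m, of "Suc k"] by (simp add: dot_lmul_matrix)
    then show ?thesis
      using vec_mult_matA_infnorm_le[OF letters measure_vectors_coneD[OF m], of "z v* prefix_mat k" k "Suc k"]
      by (simp add: matA_word_prefix_Suc vector_matrix_mul_assoc)
  qed
  then have anti: "?a l \<le> ?a k" if "k \<le> l" for k l
    using that decseq_SucI[of ?a] unfolding decseq_def by blast
  have norm: "?a (n j) \<le> infnorm z * mnorm_on (prefix_mat (n j)) (coneD_word (prefix_word w (n j)))" for j
    by (rule infnorm_vec_mult_le_mnorm_on[OF _ z])
      (use measure_vectors_prefix[OF m] measure_vectors_coneD[OF m] in \<open>auto simp: coneD_word_def\<close>)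
  let ?b = "\<lambda>j. infnorm z * ((real (n (Suc j)) - real (n j)) *
      mnorm_on (prefix_mat (n j)) (coneD_word (prefix_word w (n j))))"
  have mono: "n j \<le> n (Suc j)" for j using n_increasing by (simp add: strict_mono_less_eq)
  have gap: "(\<Sum>k=n j..<n (Suc j). ?a k) \<le> ?b j" for j
  proof -
    have "(\<Sum>k=n j..<n (Suc j). ?a k) \<le> (\<Sum>k=n j..<n (Suc j). ?a (n j))"
      by (intro sum_mono anti) auto
    also have "\<dots> = (real (n (Suc j)) - real (n j)) * ?a (n j)" using mono by (simp add: of_nat_diff)
    also have "\<dots> \<le> (real (n (Suc j)) - real (n j)) *
        (infnorm z * mnorm_on (prefix_mat (n j)) (coneD_word (prefix_word w (n j))))"
      using mono norm by (intro mult_left_mono) auto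
    finally show ?thesis by (simp add: mult.left_commute)
  qed
  have b0: "?b j \<ge> 0" for j using gap[of j] sum_nonneg[of "{n j..<n (Suc j)}" ?a] infnorm_pos_le
    by (meson order.trans)
  have sb: "summable ?b" using summable_norms by (rule summable_mult)
  have partial: "(\<Sum>k<n J. ?a k) \<le> (\<Sum>k<n 0. ?a k) + (\<Sum>j<J. ?b j)" for J
  proof (induction J)
    case (Suc J)
    have "(\<Sum>k<n (Suc J). ?a k) = (\<Sum>k<n J. ?a k) + (\<Sum>k=n J..<n (Suc J). ?a k)"
      using mono[of J] sum.atLeastLessThan_concat[of 0 "n J" "n (Suc J)" ?a] by (simp add: atLeast0LessThan)
    then show ?case using Suc gap[of J] by simp
  qed simp
  show ?thesis
  proof (rule summableI_nonneg_bounded)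
    fix J
    have "(\<Sum>k<J. ?a k) \<le> (\<Sum>k<n J. ?a k)"
      using strict_mono_imp_increasing[OF n_increasing, of J]
      by (intro sum_mono2) (auto simp: infnorm_pos_le)
    also note partial
    also have "(\<Sum>j<J. ?b j) \<le> suminf ?b" by (rule sum_le_suminf[OF sb]) (use b0 in auto)
    finally show "(\<Sum>k<J. ?a k) \<le> (\<Sum>k<n 0. ?a k) + suminf ?b" by simp
  qed (simp add: infnorm_pos_le)
qed

lemma measure_vectors_unique:
  assumes m: "measure_vectors m" and m': "measure_vectors m'"
  shows "m = m'"
proof -
  have orth: "z \<bullet> m' 0 = 0" if z: "z \<bullet> m 0 = 0" for z
  proof -
    have lim: "(\<lambda>k. 3 * infnorm (z v* prefix_mat k)) \<longlonglongrightarrow> 3 * 0"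
      by (intro tendsto_intros summable_LIMSEQ_zero summable_infnorm_prefix[OF m z])
    have "\<bar>z \<bullet> m' 0\<bar> \<le> 3 * infnorm (z v* prefix_mat k)" for k
    proof -
      have "\<bar>z \<bullet> m' 0\<bar> = \<bar>\<Sum>i\<in>UNIV. (z v* prefix_mat k) $ i * m' k $ i\<bar>"
        using dot_lmul_matrix[of z "prefix_mat k" "m' k"] measure_vectors_prefix[OF m', of k]
        by (simp add: inner_vec_def)
      also have "\<dots> \<le> (\<Sum>i\<in>UNIV. \<bar>(z v* prefix_mat k) $ i\<bar> * \<bar>m' k $ i\<bar>)"
        unfolding abs_mult[symmetric] by (rule sum_abs)
      also have "\<dots> \<le> (\<Sum>i\<in>(UNIV::3 set). infnorm (z v* prefix_mat k) * 1)"
        using measure_vectorsD(2,3)[OF m']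
        by (intro sum_mono mult_mono component_le_infnorm_cart) (auto simp: infnorm_pos_le)
      finally show ?thesis by simp
    qed
    then have "\<bar>z \<bullet> m' 0\<bar> \<le> 3 * 0" using LIMSEQ_le_const[OF lim] by blast
    then show ?thesis by simp
  qed
  have "m' 0 $ i = m 0 $ i" for i
  proof -
    \<comment> \<open>The \<open>i\<close>-th unit vector minus \<open>m 0 $ i\<close> times the
      all-ones vector. It is orthogonal to \<open>m 0\<close> because the entries of
      \<open>m 0\<close> sum to 1; orthogonality to \<open>m' 0\<close> then compares the
      \<open>i\<close>-th entries.\<close>
    let ?z = "axis i 1 - (\<chi> j. m 0 $ i)"
    have "?z \<bullet> v = v $ i - m 0 $ i * (\<Sum>j\<in>UNIV. v $ j)" for v
      by (simp add: inner_diff_left inner_axis' inner_vec_def[of "\<chi> j. _ j"] sum_distrib_left)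
    then show ?thesis using orth[of ?z] measure_vectorsD(4)[OF m] measure_vectorsD(4)[OF m'] by simp
  qed
  then have 0: "m 0 = m' 0" by (simp add: vec_eq_iff)
  have "m k = m' k" for k
  proof (induction k)
    case (Suc k)
    then show ?case using matA_mult_vec_inj[OF letters[of k]]
      measure_vectorsD(1)[OF m, of k] measure_vectorsD(1)[OF m', of k] by metis
  qed (rule 0)
  then show ?thesis by blast
qed

lemma vec_mult_prefix_Ints:
  assumes "\<And>i. z $ i \<in> \<int>"
  shows "(z v* prefix_mat k) $ i \<in> \<int>"
proof (induction k arbitrary: i)
  case (Suc k)
  have "\<forall>i. (z v* prefix_mat k v* matA (w k)) $ i \<in> \<int>"
    by (rule vec_mult_matA_pres[where P = "\<lambda>y. \<forall>i. y $ i \<in> \<int>", OF letters])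
      (use Suc in \<open>auto simp: forall_3 vec_mult_matB[unfolded One_nat_def]\<close>)
  then show ?case by (simp add: matA_word_prefix_Suc vector_matrix_mul_assoc)
qed (use assms in \<open>simp add: matA_word_prefix_0\<close>)

lemma vec_mult_prefix_eq_0: "z v* prefix_mat k = 0 \<Longrightarrow> z = 0"
proof (induction k)
  case (Suc k)
  then show ?case using vec_mult_matA_eq_0[OF letters[of k], of "z v* prefix_mat k"]
    by (simp add: matA_word_prefix_Suc vector_matrix_mul_assoc)
qed (simp add: matA_word_prefix_0)

lemma measure_vectors_integer_independent:
  assumes m: "measure_vectors m" and z: "\<And>i. z $ i \<in> \<int>" "z \<bullet> m 0 = 0"
  shows "z = 0"
proof -
  have "(\<lambda>k. infnorm (z v* prefix_mat k)) \<longlonglongrightarrow> 0"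
    by (intro summable_LIMSEQ_zero summable_infnorm_prefix[OF m z(2)])
  then have "\<forall>\<^sub>F k in sequentially. infnorm (z v* prefix_mat k) < 1" by (rule order_tendstoD) simp
  then obtain k where k: "infnorm (z v* prefix_mat k) < 1" by (auto simp: eventually_sequentially)
  have "(z v* prefix_mat k) $ i = 0" for i
  proof -
    have "\<bar>(z v* prefix_mat k) $ i\<bar> < 1" using component_le_infnorm_cart[of "z v* prefix_mat k" i] k by linarith
    then show ?thesis using vec_mult_prefix_Ints[OF z(1), of k i] Ints_nonzero_abs_less1 by blast
  qed
  then have "z v* prefix_mat k = 0" by (simp add: vec_eq_iff)
  then show ?thesis by (rule vec_mult_prefix_eq_0)
qed

lemma measure_vectors_rationally_independent:
  assumes m: "measure_vectors m"
  shows "rationally_independent (m 0)"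
  unfolding rationally_independent_def
proof (intro allI impI)
  fix q :: "3 \<Rightarrow> rat" and i
  assume q: "(\<Sum>i\<in>UNIV. of_rat (q i) * m 0 $ i) = 0"
  \<comment> \<open>The product of the denominators turns the rational relation into an integral
    one.\<close>
  define d where "d = (\<Prod>i\<in>UNIV. snd (quotient_of (q i)))"
  have d: "d \<noteq> 0" unfolding d_def using quotient_of_denom_pos' by (simp add: less_imp_neq[symmetric])
  let ?z = "(\<chi> i. of_int d * of_rat (q i)) :: real^3"
  have "of_int d * of_rat (q i) \<in> (\<int> :: real set)" for i
  proof -
    obtain e where e: "d = snd (quotient_of (q i)) * e"
      unfolding d_def by (metis UNIV_I dvd_prodI dvdE finite)
    have "q i = of_int (fst (quotient_of (q i))) / of_int (snd (quotient_of (q i)))"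
      by (rule quotient_of_div) simp
    moreover have "snd (quotient_of (q i)) \<noteq> 0" using quotient_of_denom_pos'[of "q i"] by simp
    ultimately have "of_int d * q i = of_int (e * fst (quotient_of (q i)))"
      unfolding e by (simp add: field_simps)
    then have "(of_rat (of_int d * q i) :: real) = of_int (e * fst (quotient_of (q i)))"
      by (metis of_rat_of_int_eq)
    then show ?thesis by (metis Ints_of_int of_rat_mult of_rat_of_int_eq)
  qed
  moreover have "?z \<bullet> m 0 = of_int d * (\<Sum>i\<in>UNIV. of_rat (q i) * m 0 $ i)"
    by (simp add: inner_vec_def sum_distrib_left mult.assoc)
  ultimately have "?z = 0" using measure_vectors_integer_independent[OF m] q by simp
  then have "?z $ i = 0" by simp
  then have "of_int d * of_rat (q i) = (0 :: real)" by simp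
  then show "q i = 0" using d by simp
qed

text \<open>By unimodularity, finer cylinders contribute no masses outside a group that contains
  those of level 1.\<close>

lemma measure_vectors_subgroup:
  assumes m: "measure_vectors m" and "\<And>i. m 0 $ i \<in> G" "\<And>a b. a \<in> G \<Longrightarrow> b \<in> G \<Longrightarrow> a - b \<in> G"
  shows "m k $ i \<in> G"
proof (induction k arbitrary: i)
  case (Suc k)
  have "(matA (w k) *v m (Suc k)) $ i \<in> G" for i
    using measure_vectorsD(1)[OF m, of k] Suc by metis
  then show ?case by (rule matA_mult_vec_subgroup[OF letters _ assms(3)])
qed (use assms in simp)

end

section \<open>Invariant measures and cylinders\<close>

text \<open>All cylinders are pulled back to \<open>X\<close> along the conjugacy \<open>\<phi>\<close>, so that measures never have to be
  transported. The cylinder of a finite path is given by its end vertex and its rank.\<close>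

locale bratteli_system = properly_ordered_bratteli B
  for B :: "('v, 'e) bratteli" +
  fixes X :: "'x topology" and T :: "'x \<Rightarrow> 'x" and \<phi> :: "'x \<Rightarrow> nat \<Rightarrow> 'e"
  assumes compact: "compact_space X"
    and nonempty: "topspace X \<noteq> {}"
    and homeo_T: "homeomorphic_map X X T"
    and homeo_\<phi>: "homeomorphic_map X (path_space B) \<phi>"
    and conj: "\<And>x. x \<in> topspace X \<Longrightarrow> \<phi> (T x) = vershik_map B (\<phi> x)"
begin

text \<open>The sets of points that agree with \<open>x\<close> form a neighbourhood basis at
  \<open>x\<close>; topological arguments on \<open>X\<close> are reduced to them.\<close>

definition agree :: "nat \<Rightarrow> 'x \<Rightarrow> 'x \<Rightarrow> bool" where
  "agree N x y \<longleftrightarrow> (\<forall>k<N. \<phi> x (Suc k) = \<phi> y (Suc k))"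

text \<open>The end vertex of the first \<open>n\<close> edges is read as the source of the next
  edge, which covers \<open>n = 0\<close> too.\<close>

definition vtx_at :: "nat \<Rightarrow> 'x \<Rightarrow> 'v" where
  "vtx_at n x = src B (\<phi> x (Suc n))"

definition rank_at :: "nat \<Rightarrow> 'x \<Rightarrow> nat" where
  "rank_at n x = path_rank B n (\<phi> x)"

definition cyl :: "nat \<Rightarrow> 'v \<Rightarrow> nat \<Rightarrow> 'x set" where
  "cyl n v k = {x \<in> topspace X. vtx_at n x = v \<and> rank_at n x = k}"

section \<open>The topology of \<open>X\<close> in terms of initial edges\<close>

lemma path_\<phi>: "x \<in> topspace X \<Longrightarrow> \<phi> x \<in> paths B"
  using homeomorphic_imp_surjective_map[OF homeo_\<phi>] by blast

lemma T_in: "x \<in> topspace X \<Longrightarrow> T x \<in> topspace X"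
  using homeomorphic_imp_surjective_map[OF homeo_T] by blast

lemma inj_\<phi>: "inj_on \<phi> (topspace X)"
  by (rule homeomorphic_imp_injective_map[OF homeo_\<phi>])

lemma agree_refl: "agree N x x"
  and agree_sym: "agree N x y \<Longrightarrow> agree N y x"
  and agree_trans: "agree N x y \<Longrightarrow> agree N y z \<Longrightarrow> agree N x z"
  and agree_mono: "agree N x y \<Longrightarrow> M \<le> N \<Longrightarrow> agree M x y"
  unfolding agree_def by auto

lemma openin_agree_class:
  assumes "x \<in> topspace X"
  shows "openin X {y \<in> topspace X. agree N x y}"
proof (induction N)
  case (Suc N)
  have "continuous_map (path_space B) (discrete_topology (edges B (Suc N))) (\<lambda>p. p (Suc N))"
    unfolding path_space_def
    by (rule continuous_map_from_subtopology, rule continuous_map_product_projection) simp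
  then have "continuous_map X (discrete_topology (edges B (Suc N))) (\<lambda>x. \<phi> x (Suc N))"
    using continuous_map_compose[OF homeomorphic_imp_continuous_map[OF homeo_\<phi>]]
    by (fastforce simp: comp_def)
  then have "openin X {y \<in> topspace X. \<phi> y (Suc N) \<in> {\<phi> x (Suc N)}}"
    by (rule openin_continuous_map_preimage) (use path_edge path_\<phi> assms in auto)
  then have "openin X ({y \<in> topspace X. \<phi> y (Suc N) \<in> {\<phi> x (Suc N)}} \<inter> {y \<in> topspace X. agree N x y})"
    using Suc by (rule openin_Int)
  then show ?case by (rule back_subst[of "openin X"]) (auto simp: agree_def less_Suc_eq)
qed (simp add: agree_def)

lemma openinI_agree:
  assumes "S \<subseteq> topspace X" "\<And>x. x \<in> S \<Longrightarrow> \<exists>N. \<forall>y\<in>topspace X. agree N x y \<longrightarrow> y \<in> S"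
  shows "openin X S"
proof (subst openin_subopen, intro ballI)
  fix x assume x: "x \<in> S"
  then obtain N where "\<forall>y\<in>topspace X. agree N x y \<longrightarrow> y \<in> S" using assms by blast
  then show "\<exists>U. openin X U \<and> x \<in> U \<and> U \<subseteq> S"
    using openin_agree_class[of x N] x assms(1) agree_refl
    by (intro exI[of _ "{y \<in> topspace X. agree N x y}"]) auto
qed

text \<open>A basic open set of the product restricts finitely many coordinates only;
  \<open>N\<close> bounds their indices.\<close>

lemma openinD_agree:
  assumes U: "openin X U" and x: "x \<in> U"
  shows "\<exists>N. \<forall>y\<in>topspace X. agree N x y \<longrightarrow> y \<in> U"
proof -
  have UX: "U \<subseteq> topspace X" using U by (rule openin_subset)
  have "openin (path_space B) (\<phi> ` U)"
    using homeomorphic_map_openness_eq[OF homeo_\<phi>] U by blast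
  then obtain W where W: "openin (product_topology (\<lambda>n. discrete_topology (edges B n)) {1..}) W"
    "\<phi> ` U = W \<inter> {x. \<forall>n\<ge>1. rng B (x n) = src B (x (Suc n))}"
    unfolding path_space_def openin_subtopology by blast
  have "\<phi> x \<in> W" using W x by blast
  then obtain V where V: "finite {i \<in> {1..}. V i \<noteq> edges B i}" "\<phi> x \<in> PiE {1..} V" "PiE {1..} V \<subseteq> W"
    using W(1) unfolding openin_product_topology_alt topspace_discrete_topology by blast
  obtain N where N: "\<And>i. i \<in> {i \<in> {1..}. V i \<noteq> edges B i} \<Longrightarrow> i \<le> N"
    using finite_nat_set_iff_bounded_le[THEN iffD1, OF V(1)] by blast
  have "y \<in> U" if y: "y \<in> topspace X" "agree N x y" for y
  proof -
    have yp: "\<phi> y \<in> paths B" using path_\<phi> y by blast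
    have "\<phi> y \<in> PiE {1..} V"
    proof (rule PiE_I)
      fix i :: nat assume i: "i \<in> {1..}"
      show "\<phi> y i \<in> V i"
      proof (cases "i \<le> N")
        case True
        then have "\<phi> y i = \<phi> x i" using y(2) i unfolding agree_def by (cases i) auto
        then show ?thesis using V(2) i by auto
      next
        case False
        then have "V i = edges B i" using N i by blast
        then show ?thesis using yp i unfolding paths_iff by auto
      qed
    next
      show "\<phi> y i = undefined" if "i \<notin> {1..}" for i
        using yp that unfolding paths_iff extensional_def by auto
    qed
    then have "\<phi> y \<in> \<phi> ` U" using V(3) W(2) yp unfolding paths_iff by auto
    then obtain z where "z \<in> U" "\<phi> y = \<phi> z" by blast
    then show ?thesis using inj_onD[OF inj_\<phi>, of y z] y(1) UX by blast
  qed
  then show ?thesis by blast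
qed

text \<open>Compactness gives a Lebesgue number for the cover: \<open>N\<close> is the largest depth
  that occurs in a finite subcover by classes of \<open>agree\<close>.\<close>

lemma agree_cover:
  assumes op: "\<And>U. U \<in> \<U> \<Longrightarrow> openin X U" and cov: "topspace X \<subseteq> \<Union>\<U>"
  shows "\<exists>N. \<forall>x\<in>topspace X. \<exists>U\<in>\<U>. \<forall>y\<in>topspace X. agree N x y \<longrightarrow> y \<in> U"
proof -
  have "\<exists>N. \<exists>U\<in>\<U>. \<forall>y\<in>topspace X. agree N x y \<longrightarrow> y \<in> U" if "x \<in> topspace X" for x
  proof -
    obtain U where "U \<in> \<U>" "x \<in> U" using cov \<open>x \<in> topspace X\<close> by blast
    then show ?thesis using openinD_agree[OF op] by blast
  qed
  then obtain N where N: "\<And>x. x \<in> topspace X \<Longrightarrow> \<exists>U\<in>\<U>. \<forall>y\<in>topspace X. agree (N x) x y \<longrightarrow> y \<in> U"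
    by metis
  let ?C = "\<lambda>x. {y \<in> topspace X. agree (N x) x y}"
  have "\<exists>\<F>. finite \<F> \<and> \<F> \<subseteq> ?C ` topspace X \<and> topspace X \<subseteq> \<Union>\<F>"
    using compact unfolding compact_space_alt
  proof (elim allE impE)
    show "(\<forall>U\<in>?C ` topspace X. openin X U) \<and> topspace X \<subseteq> \<Union>(?C ` topspace X)"
      using openin_agree_class agree_refl by auto
  qed
  then obtain \<F> where \<F>: "finite \<F>" "\<F> \<subseteq> ?C ` topspace X" "topspace X \<subseteq> \<Union>\<F>" by blast
  obtain F where F': "F \<subseteq> topspace X" "finite F" "\<F> = ?C ` F"
    using finite_subset_image[OF \<F>(1,2)] by blast
  then have F: "finite F" "F \<subseteq> topspace X" "topspace X \<subseteq> \<Union>(?C ` F)" using \<F> by simp_all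
  define M where "M = Max (N ` F)"
  have M: "N x \<le> M" if "x \<in> F" for x unfolding M_def using F(1) that by auto
  have "\<exists>U\<in>\<U>. \<forall>y\<in>topspace X. agree M x y \<longrightarrow> y \<in> U" if x: "x \<in> topspace X" for x
  proof -
    obtain z where z: "z \<in> F" "agree (N z) z x" using F x by blast
    obtain U where "U \<in> \<U>" "\<forall>y\<in>topspace X. agree (N z) z y \<longrightarrow> y \<in> U" using N z F by blast
    then show ?thesis using agree_trans[OF z(2)] agree_mono[OF _ M[OF z(1)]] by blast
  qed
  then show ?thesis by blast
qed

lemma continuous_map_agree_iff:
  fixes f :: "'x \<Rightarrow> 'a::metric_space"
  shows "continuous_map X euclidean f \<longleftrightarrow>
    (\<forall>x\<in>topspace X. \<forall>e>0. \<exists>N. \<forall>y\<in>topspace X. agree N x y \<longrightarrow> dist (f y) (f x) < e)"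
proof
  assume f: "continuous_map X euclidean f"
  show "\<forall>x\<in>topspace X. \<forall>e>0. \<exists>N. \<forall>y\<in>topspace X. agree N x y \<longrightarrow> dist (f y) (f x) < e"
  proof (intro ballI allI impI)
    fix x and e :: real assume x: "x \<in> topspace X" "e > 0"
    have "openin X {y \<in> topspace X. f y \<in> ball (f x) e}"
      by (rule openin_continuous_map_preimage[OF f]) simp
    then show "\<exists>N. \<forall>y\<in>topspace X. agree N x y \<longrightarrow> dist (f y) (f x) < e"
      using openinD_agree[of "{y \<in> topspace X. f y \<in> ball (f x) e}" x] x by (auto simp: dist_commute)
  qed
next
  assume *: "\<forall>x\<in>topspace X. \<forall>e>0. \<exists>N. \<forall>y\<in>topspace X. agree N x y \<longrightarrow> dist (f y) (f x) < e"
  show "continuous_map X euclidean f"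
    unfolding continuous_map_alt
  proof (intro conjI allI impI)
    fix U :: "'a set" assume "openin euclidean U"
    then have U: "open U" by simp
    show "openin X (f -` U \<inter> topspace X)"
    proof (rule openinI_agree)
      fix x assume x: "x \<in> f -` U \<inter> topspace X"
      then obtain e where "e > 0" "\<forall>z. dist z (f x) < e \<longrightarrow> z \<in> U"
        using U unfolding open_dist by blast
      then show "\<exists>N. \<forall>y\<in>topspace X. agree N x y \<longrightarrow> y \<in> f -` U \<inter> topspace X"
        using * x by blast
    qed simp
  qed simp
qed

lemma continuous_discrete_agree:
  assumes "continuous_map X (discrete_topology UNIV) f"
  shows "\<exists>N. \<forall>x\<in>topspace X. \<forall>y\<in>topspace X. agree N x y \<longrightarrow> f x = f y"
proof -
  let ?U = "(\<lambda>c. {x \<in> topspace X. f x \<in> {c}}) ` UNIV"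
  have "openin X U" if "U \<in> ?U" for U
    using that openin_continuous_map_preimage[OF assms, of "{_}"] by auto
  moreover have "topspace X \<subseteq> \<Union>?U" by auto
  ultimately have "\<exists>N. \<forall>x\<in>topspace X. \<exists>U\<in>?U. \<forall>y\<in>topspace X. agree N x y \<longrightarrow> y \<in> U"
    by (rule agree_cover)
  then obtain N where N: "\<forall>x\<in>topspace X. \<exists>U\<in>?U. \<forall>y\<in>topspace X. agree N x y \<longrightarrow> y \<in> U" ..
  have "f x = f y" if xy: "x \<in> topspace X" "y \<in> topspace X" "agree N x y" for x y
  proof -
    obtain U where U: "U \<in> ?U" "\<forall>y\<in>topspace X. agree N x y \<longrightarrow> y \<in> U"
      using bspec[OF N xy(1)] by blast
    then have "x \<in> U" "y \<in> U" using xy agree_refl by auto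
    then show ?thesis using U(1) by auto
  qed
  then show ?thesis by blast
qed

section \<open>Cylinders as floors of towers\<close>

lemma agree_imp_eq:
  assumes "agree (Suc n) x y"
  shows "vtx_at n x = vtx_at n y" "rank_at n x = rank_at n y"
  using assms path_rank_cong[of n "\<phi> x" "\<phi> y"] unfolding agree_def vtx_at_def rank_at_def by auto

text \<open>By \<open>path_rank_inj\<close>, end vertex and rank determine the first
  \<open>n\<close> edges; so a nonempty \<open>cyl n v k\<close> is the cylinder of a single finite
  path.\<close>

lemma eq_imp_agree:
  assumes "x \<in> topspace X" "y \<in> topspace X" "vtx_at n x = vtx_at n y" "rank_at n x = rank_at n y"
  shows "agree n x y"
  using path_rank_inj[OF path_\<phi>[OF assms(1)] path_\<phi>[OF assms(2)]] assms(3,4)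
  unfolding agree_def vtx_at_def rank_at_def by blast

lemma openin_cyl: "openin X (cyl n v k)"
  by (rule openinI_agree) (use agree_imp_eq[of n] in \<open>auto simp: cyl_def intro!: exI[of _ "Suc n"]\<close>)

lemma vtx_at_verts: "x \<in> topspace X \<Longrightarrow> vtx_at n x \<in> verts B n"
  unfolding vtx_at_def using path_vertex path_\<phi> by blast

lemma rank_at_less: "x \<in> topspace X \<Longrightarrow> rank_at n x < height B n (vtx_at n x)"
  unfolding vtx_at_def rank_at_def using path_rank_less_height path_\<phi> by blast

lemma cyl_empty: "k \<ge> height B n v \<Longrightarrow> cyl n v k = {}"
  unfolding cyl_def using rank_at_less[of _ n] by force

text \<open>Inside a tower \<open>T\<close> raises the rank by one. From a top floor it leads to
  rank 0, which is no \<open>Suc k\<close>, and the assumption says that floor \<open>k\<close> over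
  \<open>v\<close> is not the top one.\<close>

lemma T_preimage_cyl:
  assumes "Suc k < height B n v"
  shows "{x \<in> topspace X. T x \<in> cyl n v (Suc k)} = cyl n v k"
proof -
  have "vtx_at n (T x) = v \<and> rank_at n (T x) = Suc k \<longleftrightarrow> vtx_at n x = v \<and> rank_at n x = k"
    if x: "x \<in> topspace X" for x
  proof (cases "\<exists>j<n. \<not> max_edge B (\<phi> x (Suc j))")
    case True
    then obtain j where "\<not> max_edge B (\<phi> x (Suc j))" "j < n" by blast
    from path_rank_vershik[OF path_\<phi>[OF x] this] show ?thesis
      unfolding vtx_at_def rank_at_def conj[OF x] by auto
  next
    case False
    then have "rank_at n (T x) = 0" "Suc (rank_at n x) = height B n (vtx_at n x)"
      using path_rank_vershik_max[OF path_\<phi>[OF x], of n] path_rank_max[OF path_\<phi>[OF x], of n] conj[OF x]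
      unfolding vtx_at_def rank_at_def by auto
    then show ?thesis using assms by auto
  qed
  then show ?thesis using T_in unfolding cyl_def by auto
qed

text \<open>The shift in the rank counts the paths through smaller edges. By \<open>less\<close>,
  the ranks of paths through different edges into one vertex fill disjoint intervals, so the rank
  reveals the edge \<open>e\<close>.\<close>

lemma cyl_Suc:
  assumes k: "k < height B n v" and e: "e \<in> edges B (Suc n)" "src B e = v"
  shows "cyl (Suc n) (rng B e) (k + (\<Sum>f\<in>edges_below B e. height B n (src B f))) =
    {x \<in> cyl n v k. \<phi> x (Suc n) = e}"
proof -
  let ?s = "\<lambda>e. \<Sum>f\<in>edges_below B e. height B n (src B f)"
  have less: "height B n (src B f) + ?s f \<le> ?s g"
    if b: "strictly_below B f g" and f: "f \<in> edges B (Suc n)" and g: "g \<in> edges B (Suc n)" for f g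
  proof -
    have "height B n (src B f) + ?s f = (\<Sum>e\<in>insert f (edges_below B f). height B n (src B e))"
      by (simp add: sum_insert_edges_below[OF f])
    also have "\<dots> \<le> ?s g"
      by (rule sum_mono2[OF finite_edges_below[OF g]])
        (use b below_trans in \<open>auto simp: edges_below_def\<close>)
    finally show ?thesis .
  qed
  have eq: "\<phi> x (Suc n) = e"
    if x: "x \<in> topspace X" and v: "vtx_at (Suc n) x = rng B e" and r: "rank_at (Suc n) x = k + ?s e" for x
  proof -
    have f: "\<phi> x (Suc n) \<in> edges B (Suc n)" using path_edge path_\<phi>[OF x] by blast
    have "rng B (\<phi> x (Suc n)) = rng B e" using v path_step[OF path_\<phi>[OF x]] unfolding vtx_at_def by simp
    then consider "\<phi> x (Suc n) = e" | "strictly_below B (\<phi> x (Suc n)) e" | "strictly_below B e (\<phi> x (Suc n))"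
      using below_total[OF f e(1)] by blast
    then show ?thesis
      using less[OF _ f e(1)] less[OF _ e(1) f] r rank_at_less[OF x, of n] k e(2)
      unfolding rank_at_def vtx_at_def by cases auto
  qed
  show ?thesis
  proof (intro set_eqI iffI)
    fix x assume "x \<in> cyl (Suc n) (rng B e) (k + ?s e)"
    then have x: "x \<in> topspace X" "vtx_at (Suc n) x = rng B e" "rank_at (Suc n) x = k + ?s e"
      unfolding cyl_def by auto
    then show "x \<in> {x \<in> cyl n v k. \<phi> x (Suc n) = e}"
      using eq[OF x] e(2) unfolding cyl_def rank_at_def vtx_at_def by simp
  next
    fix x assume "x \<in> {x \<in> cyl n v k. \<phi> x (Suc n) = e}"
    then show "x \<in> cyl (Suc n) (rng B e) (k + ?s e)"
      using path_step[OF path_\<phi>, of x n] unfolding cyl_def rank_at_def vtx_at_def by auto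
  qed
qed

section \<open>Cylinders as a generator of the Borel sets\<close>

definition cylinders :: "'x set set" where
  "cylinders = insert {} {cyl n v k | n v k. v \<in> verts B n}"

lemma countable_cylinders: "countable cylinders"
proof -
  have "{cyl n v k | n v k. v \<in> verts B n} =
      (\<lambda>(n, v, k). cyl n v k) ` (SIGMA n:UNIV. verts B n \<times> UNIV)" by force
  moreover have "countable (SIGMA n:(UNIV :: nat set). verts B n \<times> (UNIV :: nat set))"
    using finite_verts by (intro countable_SIGMA) (auto intro: countable_finite)
  ultimately show ?thesis unfolding cylinders_def by simp
qed

lemma openin_cylinders: "C \<in> cylinders \<Longrightarrow> openin X C"
  unfolding cylinders_def using openin_cyl by auto

text \<open>Two cylinders are nested or disjoint, because the deeper one fixes all edges on which
  the other depends.\<close>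

lemma Int_stable_cylinders: "Int_stable cylinders"
proof -
  have le: "cyl n v k \<inter> cyl m u l \<in> {{}, cyl m u l}" if "n \<le> m" for n m v u k l
  proof (cases "cyl n v k \<inter> cyl m u l = {}")
    case False
    then obtain x where x: "x \<in> cyl n v k" "x \<in> cyl m u l" by blast
    have "y \<in> cyl n v k" if y: "y \<in> cyl m u l" for y
    proof -
      have "agree m y x" using x y unfolding cyl_def by (intro eq_imp_agree) auto
      then have "n < m \<Longrightarrow> vtx_at n y = vtx_at n x \<and> rank_at n y = rank_at n x"
        using agree_imp_eq[of n y x] agree_mono[of m y x "Suc n"] by auto
      then show ?thesis using x y \<open>n \<le> m\<close> unfolding cyl_def by (cases "n = m") auto
    qed
    then show ?thesis by blast
  qed simp
  show ?thesis
    unfolding Int_stable_def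
  proof (intro ballI)
    fix a b assume ab: "a \<in> cylinders" "b \<in> cylinders"
    show "a \<inter> b \<in> cylinders"
    proof (cases "a = {} \<or> b = {}")
      case False
      then obtain n v k m u l where *: "a = cyl n v k" "b = cyl m u l"
        using ab unfolding cylinders_def by blast
      have "a \<inter> b \<in> {{}, a, b}"
      proof (cases "n \<le> m")
        case True
        then show ?thesis using le[OF True, of v k u l] * by auto
      next
        case False
        then have "m \<le> n" by simp
        from le[OF this, of u l v k] show ?thesis using * by (auto simp: Int_commute)
      qed
      then show ?thesis using ab unfolding cylinders_def by auto
    qed (auto simp: cylinders_def)
  qed
qed

text \<open>An open set is the union of the cylinders that it contains, and there are only countably
  many cylinders.\<close>

lemma sets_cylinders: "sets (borel_algebra X) = sigma_sets (topspace X) cylinders"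
proof -
  have sub: "cylinders \<subseteq> Pow (topspace X)" using openin_cylinders openin_subset by blast
  have "U \<in> sigma_sets (topspace X) cylinders" if U: "openin X U" for U
  proof -
    have "U = \<Union>{C \<in> cylinders. C \<subseteq> U}"
    proof
      show "U \<subseteq> \<Union>{C \<in> cylinders. C \<subseteq> U}"
      proof
        fix x assume x: "x \<in> U"
        then have xX: "x \<in> topspace X" using U openin_subset by blast
        obtain N where N: "\<forall>y\<in>topspace X. agree N x y \<longrightarrow> y \<in> U" using openinD_agree[OF U x] by blast
        have "cyl N (vtx_at N x) (rank_at N x) \<subseteq> U"
          using N eq_imp_agree[OF xX] unfolding cyl_def by auto
        moreover have "cyl N (vtx_at N x) (rank_at N x) \<in> cylinders"
          using vtx_at_verts[OF xX] unfolding cylinders_def by blast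
        moreover have "x \<in> cyl N (vtx_at N x) (rank_at N x)" using xX unfolding cyl_def by simp
        ultimately show "x \<in> \<Union>{C \<in> cylinders. C \<subseteq> U}" by blast
      qed
    qed blast
    moreover have "\<Union>{C \<in> cylinders. C \<subseteq> U} \<in> sigma_sets (topspace X) cylinders"
      by (rule sigma_sets_UNION) (auto intro: countable_subset[OF _ countable_cylinders])
    ultimately show ?thesis by simp
  qed
  then have "sigma_sets (topspace X) {U. openin X U} = sigma_sets (topspace X) cylinders"
    using openin_cylinders sub by (intro sigma_sets_eqI) auto
  then show ?thesis unfolding borel_algebra_def
    by (subst sets_measure_of) (auto dest: openin_subset)
qed

lemma topspace_cyl: "v \<in> verts B 0 \<Longrightarrow> cyl 0 v 0 = topspace X"
  using vtx_at_verts[of _ 0] ex_root unfolding cyl_def rank_at_def by auto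

end

section \<open>Masses of cylinders under an invariant measure\<close>

locale invariant_measure = bratteli_system B X T \<phi>
  for B :: "('v, 'e) bratteli" and X :: "'x topology" and T \<phi> +
  fixes \<mu> :: "'x measure"
  assumes invariant: "\<mu> \<in> invariant_measures X T"
begin

sublocale prob_space \<mu>
  using invariant unfolding invariant_measures_def by blast

lemma space_\<mu>: "space \<mu> = topspace X"
  and sets_\<mu>: "sets \<mu> = sets (borel_algebra X)"
  and T_measurable: "T \<in> measurable \<mu> \<mu>"
  and distr_T: "distr \<mu> \<mu> T = \<mu>"
  using invariant unfolding invariant_measures_def by auto

lemma openin_sets: "openin X U \<Longrightarrow> U \<in> sets \<mu>"
  unfolding sets_\<mu> borel_algebra_def
  by (subst sets_measure_of) (auto dest: openin_subset)

lemma measure_preimage: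
  assumes "A \<in> sets \<mu>"
  shows "measure \<mu> {x \<in> topspace X. T x \<in> A} = measure \<mu> A"
proof -
  have "measure \<mu> A = measure (distr \<mu> \<mu> T) A" by (simp add: distr_T)
  also have "\<dots> = measure \<mu> (T -` A \<inter> space \<mu>)"
    by (rule measure_distr[OF T_measurable assms])
  also have "T -` A \<inter> space \<mu> = {x \<in> topspace X. T x \<in> A}" by (auto simp: space_\<mu>)
  finally show ?thesis by simp
qed

definition mass :: "nat \<Rightarrow> 'v \<Rightarrow> real" where
  "mass n v = measure \<mu> (cyl n v 0)"

text \<open>Each floor of a tower is the preimage of the next one, so invariance gives all of them
  the measure of the bottom floor.\<close>

lemma measure_cyl: "k < height B n v \<Longrightarrow> measure \<mu> (cyl n v k) = mass n v"
proof (induction k)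
  case (Suc k)
  then show ?case
    using measure_preimage[OF openin_sets[OF openin_cyl], of n v "Suc k"] T_preimage_cyl[of k n v] by simp
qed (simp add: mass_def)

text \<open>The bottom floor over \<open>v\<close> splits by the next edge. By
  \<open>cyl_Suc\<close> each piece is a floor of a tower one level deeper and so has the mass of
  that tower's bottom.\<close>

lemma mass_Suc:
  assumes v: "v \<in> verts B n" and h: "height B n v > 0"
  shows "mass n v = (\<Sum>e\<in>{e \<in> edges B (Suc n). src B e = v}. mass (Suc n) (rng B e))"
proof -
  let ?E = "{e \<in> edges B (Suc n). src B e = v}"
  let ?k = "\<lambda>e. \<Sum>f\<in>edges_below B e. height B n (src B f)"
  have eq: "{x \<in> cyl n v 0. \<phi> x (Suc n) = e} = cyl (Suc n) (rng B e) (?k e)" if "e \<in> ?E" for e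
    using cyl_Suc[OF h, of e] that by auto
  have "cyl n v 0 = (\<Union>e\<in>?E. {x \<in> cyl n v 0. \<phi> x (Suc n) = e})"
    using path_edge[OF path_\<phi>, of _ n] unfolding cyl_def vtx_at_def by auto
  also have "measure \<mu> \<dots> = (\<Sum>e\<in>?E. measure \<mu> {x \<in> cyl n v 0. \<phi> x (Suc n) = e})"
  proof (rule finite_measure_finite_Union)
    show "(\<lambda>e. {x \<in> cyl n v 0. \<phi> x (Suc n) = e}) ` ?E \<subseteq> sets \<mu>"
      using eq openin_sets[OF openin_cyl] by fastforce
  qed (use finite_edges[of n] in \<open>auto simp: disjoint_family_on_def\<close>)
  also have "\<dots> = (\<Sum>e\<in>?E. mass (Suc n) (rng B e))"
  proof (rule sum.cong[OF refl])
    fix e assume e: "e \<in> ?E"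
    have "?k e < height B (Suc n) (rng B e)"
    proof -
      have e1: "e \<in> edges B (Suc n)" using e by simp
      have "?k e < height B n (src B e) + ?k e" using h e by simp
      also have "\<dots> = (\<Sum>f\<in>insert e (edges_below B e). height B n (src B f))"
        by (simp add: sum_insert_edges_below[OF e1])
      also have "\<dots> \<le> height B (Suc n) (rng B e)"
        unfolding height.simps
        by (rule sum_mono2[OF finite_edges_into])
          (use edges_below_subset[OF e1] e1 in \<open>auto simp: edges_into_def\<close>)
      finally show ?thesis .
    qed
    then show "measure \<mu> {x \<in> cyl n v 0. \<phi> x (Suc n) = e} = mass (Suc n) (rng B e)"
      using eq[OF e] measure_cyl by simp
  qed
  finally show ?thesis by (simp add: mass_def)
qed

lemma mass_0: "v \<in> verts B 0 \<Longrightarrow> mass 0 v = 1"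
  unfolding mass_def using topspace_cyl prob_space space_\<mu> by simp

lemma continuous_borel:
  fixes f :: "'x \<Rightarrow> 'a::topological_space"
  assumes "continuous_map X euclidean f"
  shows "f \<in> borel_measurable \<mu>"
proof (rule borel_measurableI)
  fix S :: "'a set" assume "open S"
  then have "openin X {x \<in> topspace X. f x \<in> S}"
    using openin_continuous_map_preimage[OF assms] by simp
  moreover have "{x \<in> topspace X. f x \<in> S} = f -` S \<inter> space \<mu>" by (auto simp: space_\<mu>)
  ultimately show "f -` S \<inter> space \<mu> \<in> sets \<mu>" using openin_sets by metis
qed

lemma continuous_integrable:
  fixes f :: "'x \<Rightarrow> real"
  assumes f: "continuous_map X euclidean f"
  shows "integrable \<mu> f"
proof -
  have "compactin euclidean (f ` topspace X)"
    using image_compactin[OF _ f] compact unfolding compact_space_def by blast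
  then have "bounded (f ` topspace X)" using compact_imp_bounded by auto
  then obtain C where C: "\<And>x. x \<in> topspace X \<Longrightarrow> norm (f x) \<le> C"
    unfolding bounded_iff by auto
  show ?thesis
    by (rule integrable_const_bound[OF _ continuous_borel[OF f], of C]) (use C in \<open>auto simp: space_\<mu>\<close>)
qed

lemma integral_T:
  fixes f :: "'x \<Rightarrow> real"
  assumes f: "continuous_map X euclidean f"
  shows "(\<integral>x. f (T x) \<partial>\<mu>) = (\<integral>x. f x \<partial>\<mu>)"
  using integral_distr[OF T_measurable continuous_borel[OF f]] by (simp add: distr_T)

text \<open>The function is constant on every floor at level \<open>N\<close>, with value
  \<open>c v k\<close> taken at an arbitrary point of the floor, and the floors over one vertex have
  equal measure. On an empty floor \<open>c v k\<close> is arbitrary, but the indicator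
  vanishes.\<close>

lemma integral_locally_constant:
  fixes f :: "'x \<Rightarrow> int"
  assumes f: "\<And>x y. x \<in> topspace X \<Longrightarrow> y \<in> topspace X \<Longrightarrow> agree N x y \<Longrightarrow> f x = f y"
  shows "\<exists>c :: 'v \<Rightarrow> int. (\<integral>x. real_of_int (f x) \<partial>\<mu>) = (\<Sum>v\<in>verts B N. of_int (c v) * mass N v)"
proof -
  define c where "c v k = f (SOME x. x \<in> cyl N v k)" for v k
  have c: "f x = c (vtx_at N x) (rank_at N x)" if x: "x \<in> topspace X" for x
  proof -
    have "x \<in> cyl N (vtx_at N x) (rank_at N x)" using x unfolding cyl_def by simp
    then have "(SOME y. y \<in> cyl N (vtx_at N x) (rank_at N x)) \<in> cyl N (vtx_at N x) (rank_at N x)"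
      by (rule someI)
    then show ?thesis unfolding c_def
      by (intro f eq_imp_agree) (use x in \<open>auto simp: cyl_def\<close>)
  qed
  have "(\<integral>x. real_of_int (f x) \<partial>\<mu>) =
    (\<integral>x. (\<Sum>v\<in>verts B N. \<Sum>k<height B N v. of_int (c v k) * indicator (cyl N v k) x) \<partial>\<mu>)"
  proof (rule Bochner_Integration.integral_cong[OF refl])
    fix x assume "x \<in> space \<mu>"
    then have x: "x \<in> topspace X" by (simp add: space_\<mu>)
    have "(\<Sum>v\<in>verts B N. \<Sum>k<height B N v. of_int (c v k) * indicator (cyl N v k) x) =
      (\<Sum>v\<in>verts B N. \<Sum>k<height B N v. if k = rank_at N x then if v = vtx_at N x then of_int (c v k) else 0 else (0::real))"
      by (intro sum.cong) (use x in \<open>auto simp: cyl_def\<close>)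
    also have "\<dots> = (\<Sum>v\<in>verts B N. if v = vtx_at N x then of_int (c v (rank_at N x)) else 0)"
      by (intro sum.cong) (use rank_at_less[OF x] in auto)
    also have "\<dots> = real_of_int (f x)"
      using finite_verts vtx_at_verts[OF x] c[OF x] by simp
    finally show "real_of_int (f x) =
      (\<Sum>v\<in>verts B N. \<Sum>k<height B N v. of_int (c v k) * indicator (cyl N v k) x)" by simp
  qed
  also have "\<dots> = (\<Sum>v\<in>verts B N. \<Sum>k<height B N v. of_int (c v k) * measure \<mu> (cyl N v k))"
    using openin_sets[OF openin_cyl]
    by (simp add: Bochner_Integration.integral_sum emeasure_eq_measure del: sum_mult_indicator)
  also have "\<dots> = (\<Sum>v\<in>verts B N. of_int (\<Sum>k<height B N v. c v k) * mass N v)"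
    by (simp add: measure_cyl sum_distrib_right)
  finally show ?thesis by (intro exI[of _ "\<lambda>v. \<Sum>k<height B N v. c v k"])
qed

end

text \<open>The cylinders are an intersection-stable generator, and each one is empty or has the
  mass of the bottom of its tower.\<close>

lemma (in bratteli_system) invariant_measure_eqI:
  assumes "invariant_measure B X T \<phi> \<mu>" "invariant_measure B X T \<phi> \<mu>'"
    and eq: "\<And>n v. v \<in> verts B n \<Longrightarrow>
      invariant_measure.mass B X \<phi> \<mu> n v = invariant_measure.mass B X \<phi> \<mu>' n v"
  shows "\<mu> = \<mu>'"
proof -
  interpret m: invariant_measure B X T \<phi> \<mu> by fact
  interpret m': invariant_measure B X T \<phi> \<mu>' by fact
  obtain v0 where v0: "verts B 0 = {v0}" using ex_root by blast
  show ?thesis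
  proof (rule measure_eqI_generator_eq[OF Int_stable_cylinders, of "topspace X"])
    show "cylinders \<subseteq> Pow (topspace X)" using openin_cylinders openin_subset by blast
    show "emeasure \<mu> C = emeasure \<mu>' C" if "C \<in> cylinders" for C
    proof (cases "C = {}")
      case False
      then obtain n v k where C: "C = cyl n v k" "v \<in> verts B n" using \<open>C \<in> cylinders\<close> unfolding cylinders_def by blast
      then have "k < height B n v" using False cyl_empty by (meson not_le)
      then show ?thesis
        using m.measure_cyl m'.measure_cyl eq C by (simp add: m.emeasure_eq_measure m'.emeasure_eq_measure)
    qed simp
    show "range (\<lambda>_::nat. topspace X) \<subseteq> cylinders"
      using topspace_cyl[of v0] v0 unfolding cylinders_def by blast
  qed (auto simp: m.sets_\<mu> m'.sets_\<mu> sets_cylinders)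
qed

section \<open>Existence of an invariant measure\<close>

text \<open>The limits are taken along a filter on the function space: by Tychonoff the sequence \<open>g\<close>
  has a cluster point there, while it need not have a convergent subsequence.\<close>

lemma pointwise_cluster:
  fixes g :: "nat \<Rightarrow> 'a \<Rightarrow> real"
  assumes "\<And>n a. g n a \<in> {0..1}"
  obtains F L where "F \<noteq> bot" "\<And>a. ((\<lambda>h. h a) \<longlongrightarrow> L a) F"
    "\<And>P. eventually (\<lambda>n. P (g n)) sequentially \<Longrightarrow> eventually P F"
proof -
  let ?K = "PiE UNIV (\<lambda>_. {0..1}) :: ('a \<Rightarrow> real) set"
  let ?G = "filtermap g sequentially"
  have "compactin (product_topology (\<lambda>_. euclidean) UNIV) ?K"
    by (subst compactin_PiE) auto
  then have K: "compact ?K" by (simp add: euclidean_product_topology)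
  have "eventually (\<lambda>h. h \<in> ?K) ?G" using assms by (simp add: eventually_filtermap PiE_iff)
  moreover have "?G \<noteq> bot" by (simp add: filtermap_bot_iff)
  ultimately obtain L where L: "inf (nhds L) ?G \<noteq> bot" using K unfolding compact_filter by blast
  show thesis
  proof (rule that[OF L])
    fix a
    have "continuous_on UNIV (\<lambda>h :: 'a \<Rightarrow> real. h a)" by (rule continuous_on_product_coordinates)
    then have "((\<lambda>h. h a) \<longlongrightarrow> L a) (at L)" unfolding continuous_on_def by simp
    then have "((\<lambda>h. h a) \<longlongrightarrow> L a) (nhds L)"
      by (rule tendsto_at_iff_tendsto_nhds[where g = "\<lambda>h. h a", THEN iffD1])
    then show "((\<lambda>h. h a) \<longlongrightarrow> L a) (inf (nhds L) ?G)" by (rule tendsto_mono[rotated]) simp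
  next
    fix P assume "eventually (\<lambda>n. P (g n)) sequentially"
    then have "eventually P ?G" by (simp add: eventually_filtermap)
    then show "eventually P (inf (nhds L) ?G)" by (rule filter_leD[rotated]) simp
  qed
qed

section \<open>From a content on the clopen sets to an invariant measure\<close>

context bratteli_system
begin

definition clopens :: "'x set set" where
  "clopens = {A. openin X A \<and> closedin X A}"

lemma T_preimage_clopens: "A \<in> clopens \<Longrightarrow> {x \<in> topspace X. T x \<in> A} \<in> clopens"
  using openin_continuous_map_preimage[OF homeomorphic_imp_continuous_map[OF homeo_T]]
    closedin_continuous_map_preimage[OF homeomorphic_imp_continuous_map[OF homeo_T]]
  unfolding clopens_def by blast

lemma algebra_clopens: "algebra (topspace X) clopens"
  unfolding algebra_iff_Un clopens_def
  by (auto intro!: openin_Un closedin_Un dest: openin_subset)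

lemma sets_clopens: "sigma_sets (topspace X) clopens = sets (borel_algebra X)"
proof (rule antisym)
  show "sigma_sets (topspace X) clopens \<subseteq> sets (borel_algebra X)"
    unfolding borel_algebra_def
    by (subst sets_measure_of) (auto intro!: sigma_sets_mono' simp: clopens_def dest: openin_subset)
  have "closedin X (cyl n v k)" for n v k
  proof -
    have "openin X (topspace X - cyl n v k)"
      by (rule openinI_agree) (use agree_imp_eq[of n] in \<open>auto simp: cyl_def intro!: exI[of _ "Suc n"]\<close>)
    then show ?thesis unfolding closedin_def cyl_def by auto
  qed
  then have "cylinders \<subseteq> clopens"
    unfolding cylinders_def clopens_def using openin_cyl by auto
  then show "sets (borel_algebra X) \<subseteq> sigma_sets (topspace X) clopens"
    unfolding sets_cylinders by (rule sigma_sets_mono')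
qed

text \<open>Krylov and Bogoliubov: a cluster point of the visit frequencies of an orbit is an invariant
  finitely additive measure on the clopen sets; compactness makes it a premeasure.\<close>

lemma ex_invariant_content:
  obtains L where "\<And>A. 0 \<le> L A" "L (topspace X) = (1::real)"
    "\<And>A B. A \<inter> B = {} \<Longrightarrow> L (A \<union> B) = L A + L B"
    "\<And>A. A \<subseteq> topspace X \<Longrightarrow> L {x \<in> topspace X. T x \<in> A} = L A"
proof -
  obtain x0 where x0: "x0 \<in> topspace X" using nonempty by blast
  define x where "x j = (T ^^ j) x0" for j
  have x: "x j \<in> topspace X" for j unfolding x_def by (induction j) (use x0 T_in in auto)
  have xSuc: "x (Suc j) = T (x j)" for j unfolding x_def by simp
  \<comment> \<open>Averaging over \<open>Suc N\<close> points keeps the denominator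
    positive.\<close>
  define g where "g N A = (\<Sum>j<Suc N. indicator A (x j)) / real (Suc N)" for N A
  have g01: "g N A \<in> {0..1}" for N A
  proof -
    have "(\<Sum>j<Suc N. indicator A (x j)) \<le> (\<Sum>j<Suc N. 1::real)"
      by (intro sum_mono) (auto simp: indicator_def)
    moreover have "0 \<le> (\<Sum>j<Suc N. indicator A (x j) :: real)" by (intro sum_nonneg) simp
    ultimately show ?thesis unfolding g_def by (auto simp: divide_le_eq simp del: sum.lessThan_Suc)
  qed
  obtain F L where F: "F \<noteq> bot" and L: "\<And>A. ((\<lambda>h. h A) \<longlongrightarrow> L A) F"
    and ev: "\<And>P. eventually (\<lambda>n. P (g n)) sequentially \<Longrightarrow> eventually P F"
    by (rule pointwise_cluster[of g, OF g01]) blast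
  show thesis
  proof (rule that)
    show "0 \<le> L A" for A
      by (rule tendsto_lowerbound[OF L _ F], rule ev) (use g01 in auto)
    have "((\<lambda>h. h (topspace X)) \<longlongrightarrow> 1) F"
      by (rule tendsto_eventually, rule ev) (use x in \<open>auto simp: g_def\<close>)
    then show "L (topspace X) = 1" using L tendsto_unique[OF F] by blast
  next
    fix A B :: "'x set" assume AB: "A \<inter> B = {}"
    have "g n (A \<union> B) = g n A + g n B" for n
      unfolding g_def using AB by (simp add: indicator_add[symmetric] sum.distrib add_divide_distrib)
    then have "eventually (\<lambda>h. h A + h B = h (A \<union> B)) F" by (intro ev) auto
    moreover have "((\<lambda>h. h A + h B) \<longlongrightarrow> L A + L B) F" by (intro tendsto_intros L)
    ultimately have "((\<lambda>h. h (A \<union> B)) \<longlongrightarrow> L A + L B) F" by (rule Lim_transform_eventually[rotated])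
    then show "L (A \<union> B) = L A + L B" using L tendsto_unique[OF F] by blast
  next
    fix A assume A: "A \<subseteq> topspace X"
    let ?A = "{x \<in> topspace X. T x \<in> A}"
    \<comment> \<open>The visits to \<open>?A\<close> are those to \<open>A\<close> shifted by one
      step, so the two counts differ only through the first and the last point.\<close>
    have bound: "\<bar>g N ?A - g N A\<bar> \<le> 2 / real (Suc N)" for N
    proof -
      have "(\<Sum>j<Suc N. indicator ?A (x j)) = (\<Sum>j<Suc N. indicator A (x (Suc j)) :: real)"
        by (intro sum.cong) (use x xSuc in \<open>auto simp: indicator_def\<close>)
      then have "(\<Sum>j<Suc N. indicator ?A (x j)) - (\<Sum>j<Suc N. indicator A (x j)) =
          (indicator A (x (Suc N)) - indicator A (x 0) :: real)"
        using sum_lessThan_telescope[of "\<lambda>j. indicator A (x j) :: real" "Suc N"]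
        by (simp add: sum_subtractf del: sum.lessThan_Suc)
      then have "g N ?A - g N A = (indicator A (x (Suc N)) - indicator A (x 0)) / real (Suc N)"
        unfolding g_def by (simp add: diff_divide_distrib[symmetric])
      then show ?thesis
        by (simp add: divide_right_mono indicator_def abs_divide)
    qed
    have lim: "((\<lambda>h. h ?A - h A) \<longlongrightarrow> L ?A - L A) F" by (intro tendsto_intros L)
    have "((\<lambda>h. h ?A - h A) \<longlongrightarrow> 0) F"
    proof (rule tendstoI)
      fix e :: real assume "e > 0"
      have "(\<lambda>N. 2 / real (Suc N)) \<longlonglongrightarrow> 0"
        using LIMSEQ_Suc[OF tendsto_divide_0[OF tendsto_const filterlim_real_at_infinity_sequentially]]
        by simp
      then have "eventually (\<lambda>N. 2 / real (Suc N) < e) sequentially"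
        using \<open>e > 0\<close> by (rule order_tendstoD)
      then have "eventually (\<lambda>N. dist (g N ?A - g N A) 0 < e) sequentially"
        by eventually_elim (use bound in \<open>auto intro: le_less_trans\<close>)
      then show "eventually (\<lambda>h. dist (h ?A - h A) 0 < e) F" by (rule ev)
    qed
    then show "L ?A = L A" using tendsto_unique[OF F lim] by fastforce
  qed
qed

text \<open>The complements form an open cover, so finitely many suffice; the sequence decreases,
  hence later members miss all points. This makes continuity at the empty set trivial for any
  content on \<open>clopens\<close>.\<close>

lemma clopens_decseq_empty:
  assumes A: "range A \<subseteq> clopens" "decseq A" "(\<Inter>i. A i) = {}"
  shows "\<exists>n. \<forall>i\<ge>n. A i = {}"
proof -
  let ?U = "range (\<lambda>i. topspace X - A i)"
  have "openin X (topspace X - A i)" for i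
    using A(1) unfolding clopens_def by (auto simp: closedin_def)
  then have "(\<forall>U\<in>?U. openin X U) \<and> topspace X \<subseteq> \<Union>?U" using A(3) by blast
  then obtain \<F> where F: "finite \<F>" "\<F> \<subseteq> ?U" "topspace X \<subseteq> \<Union>\<F>"
    using compact[unfolded compact_space_alt, rule_format, of ?U] by blast
  obtain I where I: "finite I" "\<F> = (\<lambda>i. topspace X - A i) ` I"
    using finite_subset_image[OF F(1,2)] by blast
  obtain n where n: "\<And>i. i \<in> I \<Longrightarrow> i \<le> n" using finite_nat_set_iff_bounded_le[THEN iffD1, OF I(1)] by blast
  have "A i = {}" if i: "i \<ge> n" for i
  proof (rule ccontr)
    assume "A i \<noteq> {}"
    then obtain x where x: "x \<in> A i" by blast
    moreover have "x \<in> topspace X" using x A(1) unfolding clopens_def by (auto dest: openin_subset)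
    then obtain j where j: "j \<in> I" "x \<notin> A j" using F(3) I(2) by blast
    then have "A i \<subseteq> A j" using decseqD[OF A(2), of j i] n i by force
    then show False using x j by blast
  qed
  then show ?thesis by blast
qed

text \<open>Caratheodory extends the content from the clopen sets, and invariance passes from this
  intersection-stable generator to all Borel sets.\<close>

lemma ex_invariant_measure: "\<exists>\<mu>. \<mu> \<in> invariant_measures X T"
proof -
  obtain L where L: "\<And>A. 0 \<le> L A" "L (topspace X) = (1::real)"
    "\<And>A B. A \<inter> B = {} \<Longrightarrow> L (A \<union> B) = L A + L B"
    "\<And>A. A \<subseteq> topspace X \<Longrightarrow> L {x \<in> topspace X. T x \<in> A} = L A"
    by (rule ex_invariant_content) blast
  interpret algebra "topspace X" clopens by (rule algebra_clopens)
  have L0: "L {} = 0" using L(3)[of "{}" "{}"] by simp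
  have "\<exists>\<mu>. (\<forall>A\<in>clopens. \<mu> A = ennreal (L A)) \<and>
    measure_space (topspace X) (sigma_sets (topspace X) clopens) \<mu>"
  proof (rule caratheodory_empty_continuous)
    show "positive clopens (\<lambda>A. ennreal (L A))" by (simp add: positive_def L0)
    show "additive clopens (\<lambda>A. ennreal (L A))" unfolding additive_def using L by simp
    show "(\<lambda>i. ennreal (L (A i))) \<longlonglongrightarrow> 0"
      if A: "range A \<subseteq> clopens" "decseq A" "(\<Inter>i. A i) = {}" for A
    proof (rule tendsto_eventually)
      obtain n where "\<forall>i\<ge>n. A i = {}" using clopens_decseq_empty[OF A] by blast
      then show "eventually (\<lambda>i. ennreal (L (A i)) = 0) sequentially"
        using L0 by (intro eventually_sequentiallyI[of n]) simp
    qed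
  qed simp
  then obtain m where m: "\<And>A. A \<in> clopens \<Longrightarrow> m A = ennreal (L A)"
    and ms: "measure_space (topspace X) (sigma_sets (topspace X) clopens) m" by blast
  have sub: "clopens \<subseteq> Pow (topspace X)" by (rule space_closed)
  define \<mu> where "\<mu> = measure_of (topspace X) clopens m"
  have space: "space \<mu> = topspace X" and sets: "sets \<mu> = sigma_sets (topspace X) clopens"
    unfolding \<mu>_def using sub by (simp_all add: space_measure_of)
  have em: "emeasure \<mu> A = ennreal (L A)" if "A \<in> clopens" for A
  proof -
    have "emeasure \<mu> A = m A"
      by (rule emeasure_measure_of[OF \<mu>_def sub])
        (use ms that in \<open>auto simp: sets measure_space_def\<close>)
    then show ?thesis using m that by simp
  qed
  have meas: "T \<in> measurable \<mu> \<mu>"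
  proof (rule measurable_sigma_sets[OF sets sub])
    show "T \<in> space \<mu> \<rightarrow> topspace X" using T_in space by auto
    fix A assume A: "A \<in> clopens"
    have "T -` A \<inter> space \<mu> = {x \<in> topspace X. T x \<in> A}" using space by auto
    then show "T -` A \<inter> space \<mu> \<in> sets \<mu>" using T_preimage_clopens[OF A] sets by auto
  qed
  have "distr \<mu> \<mu> T = \<mu>"
  proof (rule measure_eqI_generator_eq[of clopens "topspace X" _ _ "\<lambda>_. topspace X"])
    show "Int_stable clopens" unfolding Int_stable_def by blast
    fix A assume A: "A \<in> clopens"
    then have "emeasure (distr \<mu> \<mu> T) A = emeasure \<mu> (T -` A \<inter> space \<mu>)"
      using sets by (intro emeasure_distr[OF meas]) auto
    also have "T -` A \<inter> space \<mu> = {x \<in> topspace X. T x \<in> A}" using space by auto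
    finally show "emeasure (distr \<mu> \<mu> T) A = emeasure \<mu> A"
      using em[OF A] em[OF T_preimage_clopens[OF A]] L(4)[of A] A sub by auto
  next
    have "emeasure (distr \<mu> \<mu> T) (topspace X) = emeasure \<mu> (T -` topspace X \<inter> space \<mu>)"
      by (rule emeasure_distr[OF meas]) (use sets in auto)
    also have "T -` topspace X \<inter> space \<mu> = topspace X" using space T_in by auto
    finally show "emeasure (distr \<mu> \<mu> T) (topspace X) \<noteq> \<infinity>" using em by simp
  qed (use sets sub in auto)
  moreover have "prob_space \<mu>" by (rule prob_spaceI) (use em space L in simp)
  ultimately show ?thesis
    unfolding invariant_measures_def using space sets meas sets_clopens by blast
qed

end

section \<open>Continuous eigenvalues\<close>

definition circle_exp :: "real \<Rightarrow> complex" where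
  "circle_exp r = exp (2 * \<i> * complex_of_real pi * complex_of_real r)"

lemma circle_exp_add: "circle_exp (r + s) = circle_exp r * circle_exp s"
  unfolding circle_exp_def by (simp add: distrib_left exp_add)

lemma circle_exp_eq_1_iff: "circle_exp r = 1 \<longleftrightarrow> r \<in> \<int>"
proof -
  have "circle_exp r = 1 \<longleftrightarrow> (\<exists>n :: int. 2 * pi * r = 2 * of_int n * pi)"
    unfolding circle_exp_def exp_eq_1 by simp
  also have "\<dots> \<longleftrightarrow> (\<exists>n :: int. r = of_int n)"
    by (intro ex_cong1) (auto simp: algebra_simps)
  finally show ?thesis by (auto simp: Ints_def)
qed

lemma circle_exp_nonzero: "circle_exp r \<noteq> 0"
  unfolding circle_exp_def by simp

lemma circle_exp_add_Ints: "s \<in> \<int> \<Longrightarrow> circle_exp (r + s) = circle_exp r"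
  using circle_exp_eq_1_iff[of s] by (simp add: circle_exp_add)

lemma circle_exp_eqI: "r - s \<in> \<int> \<Longrightarrow> circle_exp r = circle_exp s"
  using circle_exp_add_Ints[of "r - s" s] by simp

lemma norm_circle_exp: "norm (circle_exp r) = 1"
  unfolding circle_exp_def by simp

lemma tendsto_circle_exp: "(f \<longlongrightarrow> l) F \<Longrightarrow> ((\<lambda>x. circle_exp (f x)) \<longlongrightarrow> circle_exp l) F"
  unfolding circle_exp_def by (intro tendsto_intros)

lemma continuous_on_circle_exp: "continuous_on UNIV circle_exp"
  unfolding circle_exp_def by (intro continuous_intros)

section \<open>Eigenfunctions from heights close to integers\<close>

context bratteli_system
begin

text \<open>\<open>eps n v\<close> represents \<alpha> times the height modulo integers. At most
  \<open>K\<close> such terms enter at each level, so their sums along a path converge uniformly to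
  a continuous \<open>g\<close>, and \<open>circle_exp\<close> composed with \<open>g\<close> is the
  eigenfunction.\<close>

lemma continuous_eigenvalue_circle_exp:
  fixes \<alpha> :: real and eps :: "nat \<Rightarrow> 'v \<Rightarrow> real"
  assumes int: "\<And>n v. v \<in> verts B n \<Longrightarrow> \<alpha> * height B n v - eps n v \<in> \<int>"
    and bound: "\<And>n v. v \<in> verts B n \<Longrightarrow> \<bar>eps n v\<bar> \<le> b n"
    and summable: "summable b"
    and deg: "\<And>n v. v \<in> verts B (Suc n) \<Longrightarrow> card (edges_into B (Suc n) v) \<le> K"
  shows "continuous_eigenvalue X T (circle_exp \<alpha>)"
proof -
  \<comment> \<open>Modulo integers, \<alpha> times the increment of the rank from level
    \<open>n\<close> to level \<open>Suc n\<close>.\<close>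
  define t where "t n x = (\<Sum>e\<in>edges_below B (\<phi> x (Suc n)). eps n (src B e))" for n x
  have edge: "\<phi> x (Suc n) \<in> edges B (Suc n)" if "x \<in> topspace X" for x n
    using path_edge path_\<phi> that by blast
  have below: "src B e \<in> verts B n"
    if "x \<in> topspace X" "e \<in> edges_below B (\<phi> x (Suc n))" for x n e
    using edges_below_subset[OF edge[OF that(1)]] that(2) src_edge unfolding edges_into_def by blast
  have b0: "b n \<ge> 0" for n
  proof -
    obtain x where "x \<in> topspace X" using nonempty by blast
    then show ?thesis using bound[OF vtx_at_verts, of x n] by linarith
  qed
  have tb: "\<bar>t n x\<bar> \<le> real K * b n" if x: "x \<in> topspace X" for n x
  proof -
    have "\<bar>t n x\<bar> \<le> (\<Sum>e\<in>edges_below B (\<phi> x (Suc n)). \<bar>eps n (src B e)\<bar>)"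
      unfolding t_def by (rule sum_abs)
    also have "\<dots> \<le> (\<Sum>e\<in>edges_below B (\<phi> x (Suc n)). b n)"
      by (intro sum_mono bound below[OF x])
    also have "\<dots> = card (edges_below B (\<phi> x (Suc n))) * b n" by simp
    also have "\<dots> \<le> real K * b n"
    proof (rule mult_right_mono[OF _ b0])
      have "card (edges_below B (\<phi> x (Suc n))) \<le> card (edges_into B (Suc n) (rng B (\<phi> x (Suc n))))"
        by (rule card_mono[OF finite_edges_into]) (use edges_below_subset[OF edge[OF x]] in blast)
      also have "\<dots> \<le> K" by (rule deg[OF rng_edge[OF edge[OF x]]])
      finally show "real (card (edges_below B (\<phi> x (Suc n)))) \<le> real K" by simp
    qed
    finally show ?thesis .
  qed
  have sKb: "summable (\<lambda>n. real K * b n)" by (intro summable_mult summable)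
  have st: "summable (\<lambda>n. t n x)" if "x \<in> topspace X" for x
    by (rule summable_comparison_test'[OF sKb]) (use tb[OF that] in simp)
  define g where "g x = (\<Sum>n. t n x)" for x
  have cont: "continuous_map X euclidean g"
    unfolding continuous_map_agree_iff
  proof (intro ballI allI impI)
    fix x and e :: real assume x: "x \<in> topspace X" and e: "e > 0"
    obtain N where N: "norm (\<Sum>i. real K * b (i + N)) < e / 2"
      using suminf_exist_split[of "e / 2", OF _ sKb] e by auto
    have tail: "\<bar>\<Sum>i. t (i + N) y\<bar> < e / 2" if y: "y \<in> topspace X" for y
    proof -
      have s: "summable (\<lambda>i. real K * b (i + N))" using sKb by (rule summable_ignore_initial_segment)
      have "norm (\<Sum>i. t (i + N) y) \<le> (\<Sum>i. real K * b (i + N))"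
        by (rule norm_suminf_le[OF _ s]) (use tb[OF y] in simp)
      then show ?thesis using N by simp
    qed
    have "dist (g y) (g x) < e" if y: "y \<in> topspace X" "agree N x y" for y
    proof -
      have "(\<Sum>i<N. t i y) = (\<Sum>i<N. t i x)"
        using y(2) unfolding t_def agree_def by (intro sum.cong) auto
      then have "g y - g x = (\<Sum>i. t (i + N) y) - (\<Sum>i. t (i + N) x)"
        unfolding g_def using suminf_split_initial_segment[OF st[OF x], of N]
          suminf_split_initial_segment[OF st[OF y(1)], of N] by simp
      then show ?thesis using tail[OF x] tail[OF y(1)] by (simp add: dist_real_def)
    qed
    then show "\<exists>N. \<forall>y\<in>topspace X. agree N x y \<longrightarrow> dist (g y) (g x) < e" by blast
  qed
  have partial: "circle_exp (\<Sum>i<n. t i x) = circle_exp (\<alpha> * rank_at n x)" if x: "x \<in> topspace X" for n x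
  proof (rule circle_exp_eqI, induction n)
    case (Suc n)
    have "(\<Sum>e\<in>edges_below B (\<phi> x (Suc n)). \<alpha> * height B n (src B e) - eps n (src B e)) \<in> \<int>"
      by (intro Ints_sum int below[OF x])
    from Ints_diff[OF Suc this] show ?case
      unfolding t_def rank_at_def
      by (simp add: sum_subtractf sum_distrib_left[symmetric] algebra_simps)
  qed (simp add: rank_at_def)
  have lim: "(\<lambda>n. circle_exp (\<alpha> * rank_at n x)) \<longlonglongrightarrow> circle_exp (g x)" if x: "x \<in> topspace X" for x
    unfolding partial[OF x, symmetric] g_def
    by (intro tendsto_circle_exp summable_LIMSEQ st[OF x])
  have "circle_exp (g (T x)) = circle_exp \<alpha> * circle_exp (g x)" if x: "x \<in> topspace X" for x
  proof -
    have lim2: "(\<lambda>n. circle_exp \<alpha> * circle_exp (\<alpha> * rank_at n x)) \<longlonglongrightarrow> circle_exp \<alpha> * circle_exp (g x)"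
      by (intro tendsto_intros lim x)
    show ?thesis
    \<comment> \<open>If \<open>x\<close> has a non-maximal edge, its ranks at large levels grow by
      one under \<open>T\<close>. Otherwise \<open>x\<close> runs along the maximal path,
      \<open>T x\<close> has rank 0 at all levels, and \<alpha> times the heights along
      \<open>x\<close> tends to 0 modulo integers.\<close>
    proof (cases "\<exists>k. \<not> max_edge B (\<phi> x (Suc k))")
      case True
      then obtain k where k: "\<not> max_edge B (\<phi> x (Suc k))" by blast
      have "rank_at n (T x) = Suc (rank_at n x)" if "k < n" for n
        unfolding rank_at_def conj[OF x] by (rule path_rank_vershik[OF path_\<phi>[OF x] k that])
      then have "circle_exp \<alpha> * circle_exp (\<alpha> * rank_at n x) = circle_exp (\<alpha> * rank_at n (T x))" if "n \<ge> Suc k" for n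
        using that by (simp add: circle_exp_add[symmetric] algebra_simps)
      then have "\<forall>\<^sub>F n in sequentially. circle_exp \<alpha> * circle_exp (\<alpha> * rank_at n x) = circle_exp (\<alpha> * rank_at n (T x))"
        by (intro eventually_sequentiallyI[of "Suc k"])
      from Lim_transform_eventually[OF lim2 this] show ?thesis
        using lim[OF T_in[OF x]] LIMSEQ_unique by blast
    next
      case False
      then have max: "\<And>k. max_edge B (\<phi> x (Suc k))" by blast
      have 0: "rank_at n (T x) = 0" for n
        unfolding rank_at_def conj[OF x] using path_rank_vershik_max[OF path_\<phi>[OF x]] max by blast
      have 1: "circle_exp \<alpha> * circle_exp (\<alpha> * rank_at n x) = circle_exp (eps n (vtx_at n x))" for n
      proof -
        have "height B n (vtx_at n x) = Suc (rank_at n x)"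
          using path_rank_max[OF path_\<phi>[OF x], of n] max unfolding rank_at_def vtx_at_def by simp
        then have "circle_exp \<alpha> * circle_exp (\<alpha> * rank_at n x) = circle_exp (\<alpha> * height B n (vtx_at n x))"
          by (simp add: circle_exp_add[symmetric] algebra_simps)
        also have "\<dots> = circle_exp (eps n (vtx_at n x))" by (intro circle_exp_eqI int vtx_at_verts x)
        finally show ?thesis .
      qed
      have "(\<lambda>n. eps n (vtx_at n x)) \<longlonglongrightarrow> 0"
        by (rule Lim_null_comparison[OF _ summable_LIMSEQ_zero[OF summable]])
          (use bound[OF vtx_at_verts[OF x]] in simp)
      from tendsto_circle_exp[OF this] have "circle_exp \<alpha> * circle_exp (g x) = circle_exp 0"
        using lim2 unfolding 1 using LIMSEQ_unique by blast
      moreover have "circle_exp (g (T x)) = circle_exp 0"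
        using lim[OF T_in[OF x]] unfolding 0 by (simp add: LIMSEQ_const_iff)
      ultimately show ?thesis by simp
    qed
  qed
  moreover have "continuous_map X euclidean (\<lambda>x. circle_exp (g x))"
    using continuous_map_compose[OF cont, of euclidean circle_exp] continuous_on_circle_exp
    by (simp add: comp_def)
  moreover have "\<exists>x\<in>topspace X. circle_exp (g x) \<noteq> 0" using nonempty circle_exp_nonzero by blast
  ultimately show ?thesis
    unfolding continuous_eigenvalue_def by (intro exI[of _ "\<lambda>x. circle_exp (g x)"]) auto
qed

section \<open>From an eigenfunction to the integral of an integer-valued function\<close>

lemma eigenfunction_nonzero:
  assumes min: "\<And>x. x \<in> topspace X \<Longrightarrow> X closure_of (full_orbit X T x) = topspace X"
    and f: "continuous_map X euclidean f" "\<And>x. x \<in> topspace X \<Longrightarrow> f (T x) = c * f x"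
    and nz: "x0 \<in> topspace X" "f x0 \<noteq> (0 :: complex)" and c: "c \<noteq> 0" and x: "x \<in> topspace X"
  shows "f x \<noteq> 0"
proof
  assume 0: "f x = 0"
  have pow: "y \<in> topspace X \<Longrightarrow> (T ^^ n) y \<in> topspace X \<and> f ((T ^^ n) y) = c ^ n * f y" for n y
    by (induction n) (auto simp: T_in f(2))
  \<comment> \<open>As \<open>c \<noteq> 0\<close>, zeros also propagate backwards, so the closed
    zero set contains a dense full orbit.\<close>
  have "full_orbit X T x \<subseteq> {y \<in> topspace X. f y \<in> {0}}"
    unfolding full_orbit_def using 0 pow x c by fastforce
  moreover have "closedin X {y \<in> topspace X. f y \<in> {0}}"
    by (rule closedin_continuous_map_preimage[OF f(1)]) simp
  ultimately have "X closure_of (full_orbit X T x) \<subseteq> {y \<in> topspace X. f y \<in> {0}}"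
    by (rule closure_of_minimal)
  then show False using min[OF x] nz by auto
qed

text \<open>An eigenfunction is, up to its modulus, of the form \<open>circle_exp \<circ> g\<close> with \<open>g\<close> real and continuous:
  on a sufficiently fine partition into cylinders, the argument relative to the value at a
  representative point of each cylinder is continuous.\<close>

lemma continuous_lift:
  assumes f: "continuous_map X euclidean f" and nz: "\<And>x. x \<in> topspace X \<Longrightarrow> f x \<noteq> (0 :: complex)"
  obtains g where "continuous_map X euclideanreal g"
    "\<And>x. x \<in> topspace X \<Longrightarrow> f x = of_real (norm (f x)) * circle_exp (g x)"
proof -
  let ?V = "\<lambda>z. {y \<in> topspace X. f y \<in> {w. Re (w / f z) > 0}}"
  have "openin X (?V z)" if "z \<in> topspace X" for z
  proof (rule openin_continuous_map_preimage[OF f])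
    have "open {w. Re (w / f z) > 0}"
      by (intro open_Collect_less continuous_intros) (use nz that in auto)
    then show "openin euclidean {w. Re (w / f z) > 0}" by simp
  qed
  then have "\<And>U. U \<in> ?V ` topspace X \<Longrightarrow> openin X U" by blast
  moreover have "topspace X \<subseteq> \<Union>(?V ` topspace X)" using nz by auto
  ultimately have "\<exists>N. \<forall>x\<in>topspace X. \<exists>U\<in>?V ` topspace X. \<forall>y\<in>topspace X. agree N x y \<longrightarrow> y \<in> U"
    by (rule agree_cover)
  then obtain N where N: "\<forall>x\<in>topspace X. \<exists>U\<in>?V ` topspace X. \<forall>y\<in>topspace X. agree N x y \<longrightarrow> y \<in> U" ..
  \<comment> \<open>Values at points of one class lie in a common open half-plane bounded by a line
    through 0, so their quotient avoids the branch cut of \<open>Arg\<close>.\<close>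
  have slit: "f y / f x \<notin> \<real>\<^sub>\<le>\<^sub>0" if xy: "x \<in> topspace X" "y \<in> topspace X" "agree N x y" for x y
  proof
    assume "f y / f x \<in> \<real>\<^sub>\<le>\<^sub>0"
    then obtain r where r: "f y / f x = of_real r" "r \<le> 0" unfolding nonpos_Reals_def by blast
    obtain U where U: "U \<in> ?V ` topspace X" "\<forall>y\<in>topspace X. agree N x y \<longrightarrow> y \<in> U"
      using bspec[OF N xy(1)] by blast
    then obtain z where z: "x \<in> ?V z" "y \<in> ?V z" using xy agree_refl[of N x] by blast
    have "f y / f z = of_real r * (f x / f z)" using r nz[OF xy(1)] by (simp add: field_simps)
    then have "Re (f y / f z) = r * Re (f x / f z)"
      by (metis Re_complex_of_real Im_complex_of_real times_complex.sel(1) mult_zero_left diff_zero)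
    moreover have "r * Re (f x / f z) \<le> 0" using r(2) z(1) by (intro mult_nonpos_nonneg) auto
    ultimately show False using z(2) by simp
  qed
  define rep where "rep x = (SOME y. y \<in> topspace X \<and> agree N x y)" for x
  have rep: "rep x \<in> topspace X" "agree N x (rep x)" if "x \<in> topspace X" for x
    using someI[of "\<lambda>y. y \<in> topspace X \<and> agree N x y" x] that agree_refl unfolding rep_def by auto
  have rep_eq: "rep y = rep x" if "agree N x y" for x y
  proof -
    have "agree N y z \<longleftrightarrow> agree N x z" for z using that agree_sym agree_trans by blast
    then show ?thesis unfolding rep_def by simp
  qed
  define g where "g x = (Arg (f x / f (rep x)) + Arg (f (rep x))) / (2 * pi)" for x
  show thesis
  proof (rule that[of g])
    show "f x = of_real (norm (f x)) * circle_exp (g x)" if x: "x \<in> topspace X" for x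
    proof -
      have z: "f (rep x) \<noteq> 0" "f x / f (rep x) \<noteq> 0" using nz x rep by auto
      have "f x = (f x / f (rep x)) * f (rep x)" using z by simp
      also have "\<dots> = (of_real (norm (f x / f (rep x))) * exp (\<i> * Arg (f x / f (rep x)))) *
          (of_real (norm (f (rep x))) * exp (\<i> * Arg (f (rep x))))"
        using Arg_eq[OF z(1)] Arg_eq[OF z(2)] by simp
      also have "\<dots> = of_real (norm (f x / f (rep x)) * norm (f (rep x))) *
          exp (\<i> * Arg (f x / f (rep x)) + \<i> * Arg (f (rep x)))"
        by (simp add: exp_add)
      also have "norm (f x / f (rep x)) * norm (f (rep x)) = norm (f x)"
        using z by (simp add: norm_divide)
      also have "exp (\<i> * Arg (f x / f (rep x)) + \<i> * Arg (f (rep x))) = circle_exp (g x)"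
      proof -
        have "circle_exp (g x) = exp (\<i> * of_real (2 * pi * g x))" unfolding circle_exp_def by (simp add: mult_ac)
        also have "2 * pi * g x = Arg (f x / f (rep x)) + Arg (f (rep x))" unfolding g_def by simp
        finally show ?thesis by (simp add: distrib_left)
      qed
      finally show ?thesis .
    qed
    show "continuous_map X euclideanreal g"
      unfolding continuous_map_agree_iff
    proof (intro ballI allI impI)
      fix x and e :: real assume x: "x \<in> topspace X" and e: "e > 0"
      let ?r = "f (rep x)"
      have "isCont (\<lambda>w. Arg (w / ?r) / (2 * pi)) (f x)"
        using slit[OF rep(1)[OF x] x agree_sym[OF rep(2)[OF x]]] nz[OF rep(1)[OF x]]
        by (intro isCont_divide isCont_o2[OF _ continuous_at_Arg] continuous_intros) auto
      then obtain d where d: "d > 0" "\<And>w. dist w (f x) < d \<Longrightarrow>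
          dist (Arg (w / ?r) / (2 * pi)) (Arg (f x / ?r) / (2 * pi)) < e"
        using e unfolding continuous_at_eps_delta by blast
      obtain N' where N': "\<forall>y\<in>topspace X. agree N' x y \<longrightarrow> dist (f y) (f x) < d"
        using f[unfolded continuous_map_agree_iff] x d(1) by blast
      \<comment> \<open>Points that agree to depth \<open>N\<close> share their representative, so
        only the argument of the quotient varies.\<close>
      have "dist (g y) (g x) < e" if y: "y \<in> topspace X" "agree (max N N') x y" for y
      proof -
        have "rep y = rep x" "dist (f y) (f x) < d"
          using rep_eq agree_mono[OF y(2)] N' y(1) by auto
        then show ?thesis using d(2)[of "f y"]
          unfolding g_def by (simp add: dist_real_def add_divide_distrib)
      qed
      then show "\<exists>N. \<forall>y\<in>topspace X. agree N x y \<longrightarrow> dist (g y) (g x) < e" by blast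
    qed
  qed
qed

end

lemma (in invariant_measure) eigenvalue_integral:
  assumes min: "\<And>x. x \<in> topspace X \<Longrightarrow> X closure_of (full_orbit X T x) = topspace X"
    and ev: "continuous_eigenvalue X T (circle_exp \<alpha>)"
  shows "\<exists>k. continuous_map X (discrete_topology (UNIV :: int set)) k \<and>
    (\<integral>x. real_of_int (k x) \<partial>\<mu>) = \<alpha>"
proof -
  obtain f x0 where f: "continuous_map X euclidean f" "x0 \<in> topspace X" "f x0 \<noteq> 0"
    "\<And>x. x \<in> topspace X \<Longrightarrow> f (T x) = circle_exp \<alpha> * f x"
    using ev unfolding continuous_eigenvalue_def by blast
  have nz: "f x \<noteq> 0" if "x \<in> topspace X" for x
    using eigenfunction_nonzero[OF min f(1,4) f(2,3) circle_exp_nonzero that] .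
  obtain g where g: "continuous_map X euclideanreal g"
    "\<And>x. x \<in> topspace X \<Longrightarrow> f x = of_real (norm (f x)) * circle_exp (g x)"
    using continuous_lift[OF f(1) nz] by blast
  define h where "h x = \<alpha> + g x - g (T x)" for x
  have gT: "continuous_map X euclideanreal (\<lambda>x. g (T x))"
    using continuous_map_compose[OF homeomorphic_imp_continuous_map[OF homeo_T] g(1)]
    by (simp add: comp_def)
  have hc: "continuous_map X euclideanreal h"
    unfolding h_def by (intro continuous_intros continuous_map_add continuous_map_diff g gT) simp
  have hint: "h x \<in> \<int>" if x: "x \<in> topspace X" for x
  proof -
    \<comment> \<open>The eigenvalue has modulus 1, so moduli cancel in the eigenvalue equation and
      only the phases remain.\<close>
    have "norm (f (T x)) = norm (f x)" using f(4)[OF x] norm_circle_exp[of \<alpha>] by (simp add: norm_mult)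
    then have "of_real (norm (f x)) * circle_exp (g (T x)) = of_real (norm (f x)) * (circle_exp \<alpha> * circle_exp (g x))"
      using g(2)[OF T_in[OF x]] g(2)[OF x] f(4)[OF x] by (metis mult.left_commute)
    then have "circle_exp (g (T x)) = circle_exp \<alpha> * circle_exp (g x)" using nz[OF x] by simp
    moreover have "circle_exp (h x) * circle_exp (g (T x)) = circle_exp \<alpha> * circle_exp (g x)"
      unfolding h_def by (simp add: circle_exp_add[symmetric])
    ultimately have "circle_exp (h x) = 1" using circle_exp_nonzero by (metis mult_cancel_right mult.left_neutral)
    then show ?thesis by (simp add: circle_exp_eq_1_iff)
  qed
  have k: "real_of_int \<lfloor>h x\<rfloor> = h x" if "x \<in> topspace X" for x
    using hint[OF that] by (metis Ints_cases floor_of_int)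
  have "continuous_map X (discrete_topology (UNIV :: int set)) (\<lambda>x. \<lfloor>h x\<rfloor>)"
    unfolding continuous_map_alt
  proof (intro conjI allI impI)
    fix U :: "int set"
    show "openin X ((\<lambda>x. \<lfloor>h x\<rfloor>) -` U \<inter> topspace X)"
    proof (rule openinI_agree)
      fix x assume x: "x \<in> (\<lambda>x. \<lfloor>h x\<rfloor>) -` U \<inter> topspace X"
      then obtain N where N: "\<forall>y\<in>topspace X. agree N x y \<longrightarrow> dist (h y) (h x) < 1"
        using hc[unfolded continuous_map_agree_iff] by (meson IntE zero_less_one)
      have "\<lfloor>h y\<rfloor> = \<lfloor>h x\<rfloor>" if y: "y \<in> topspace X" "agree N x y" for y
      proof -
        have "\<bar>real_of_int \<lfloor>h y\<rfloor> - real_of_int \<lfloor>h x\<rfloor>\<bar> < 1"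
          using N y x k[of x] k[of y] by (auto simp: dist_real_def)
        then show ?thesis by linarith
      qed
      then show "\<exists>N. \<forall>y\<in>topspace X. agree N x y \<longrightarrow> y \<in> (\<lambda>x. \<lfloor>h x\<rfloor>) -` U \<inter> topspace X"
        using x by (intro exI[of _ N]) auto
    qed simp
  qed simp
  moreover have "(\<integral>x. real_of_int \<lfloor>h x\<rfloor> \<partial>\<mu>) = (\<integral>x. h x \<partial>\<mu>)"
    by (rule Bochner_Integration.integral_cong[OF refl]) (use k space_\<mu> in simp)
  moreover have "(\<integral>x. h x \<partial>\<mu>) = \<alpha>"
    unfolding h_def using continuous_integrable[OF g(1)] continuous_integrable[OF gT] integral_T[OF g(1)]
    by (simp add: prob_space)
  ultimately show ?thesis by (intro exI[of _ "\<lambda>x. \<lfloor>h x\<rfloor>"]) simp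
qed

section \<open>The system with the given incidence matrices\<close>

locale matrix_system = bratteli_system B X T \<phi> + summable_word w n
  for B :: "('v, 'e) bratteli" and X :: "'x topology" and T \<phi> w n +
  fixes vtx :: "nat \<Rightarrow> 3 \<Rightarrow> 'v"
  assumes matrices: "has_incidence_matrices B vtx (\<lambda>k. matA (w (k - 2)))"
begin

section \<open>Edges and heights counted by the matrices\<close>

lemma bij_vtx: "bij_betw (vtx (Suc k)) UNIV (verts B (Suc k))"
  using matrices unfolding has_incidence_matrices_def by simp

lemma vtx_verts: "vtx (Suc k) i \<in> verts B (Suc k)"
  using bij_betwE[OF bij_vtx] by blast

lemma incidence_1: "v \<in> verts B 0 \<Longrightarrow> incidence B (Suc 0) v (vtx (Suc 0) i) = 1"
  using matrices unfolding has_incidence_matrices_def by simp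

lemma incidence_Suc:
  "real (incidence B (Suc (Suc k)) (vtx (Suc k) i) (vtx (Suc (Suc k)) j)) = matA (w k) $ i $ j"
proof -
  have "\<forall>n\<ge>2. \<forall>i j. real (incidence B n (vtx (n - 1) i) (vtx n j)) = matA (w (n - 2)) $ i $ j"
    using matrices unfolding has_incidence_matrices_def by blast
  from this[rule_format, of "Suc (Suc k)" i j] show ?thesis by simp
qed

text \<open>Grouping edges by one end turns sums over edges into products with incidence matrices:
  here by range, in \<open>sum_edges_into\<close> by source.\<close>

lemma sum_edges_from:
  fixes f :: "'v \<Rightarrow> real"
  shows "(\<Sum>e\<in>{e \<in> edges B (Suc k). src B e = v}. f (rng B e)) =
    (\<Sum>i\<in>UNIV. real (incidence B (Suc k) v (vtx (Suc k) i)) * f (vtx (Suc k) i))"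
proof -
  let ?E = "{e \<in> edges B (Suc k). src B e = v}"
  have "(\<Sum>e\<in>?E. f (rng B e)) = (\<Sum>u\<in>verts B (Suc k). \<Sum>e\<in>{e \<in> ?E. rng B e = u}. f (rng B e))"
    by (rule sum.group[symmetric]) (use finite_edges finite_verts rng_edge in auto)
  also have "\<dots> = (\<Sum>u\<in>verts B (Suc k). real (incidence B (Suc k) v u) * f u)"
    unfolding incidence_def by (intro sum.cong refl) (simp add: conj_assoc)
  also have "\<dots> = (\<Sum>i\<in>UNIV. real (incidence B (Suc k) v (vtx (Suc k) i)) * f (vtx (Suc k) i))"
    by (rule sum.reindex_bij_betw[OF bij_vtx, symmetric])
  finally show ?thesis .
qed

lemma sum_edges_into:
  fixes f :: "'v \<Rightarrow> real"
  shows "(\<Sum>e\<in>edges_into B (Suc (Suc k)) v. f (src B e)) =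
    (\<Sum>i\<in>UNIV. real (incidence B (Suc (Suc k)) (vtx (Suc k) i) v) * f (vtx (Suc k) i))"
proof -
  let ?E = "edges_into B (Suc (Suc k)) v"
  have "(\<Sum>e\<in>?E. f (src B e)) = (\<Sum>u\<in>verts B (Suc k). \<Sum>e\<in>{e \<in> ?E. src B e = u}. f (src B e))"
    by (rule sum.group[symmetric]) (use finite_edges_into finite_verts src_edge in \<open>auto simp: edges_into_def\<close>)
  also have "\<dots> = (\<Sum>u\<in>verts B (Suc k). real (incidence B (Suc (Suc k)) u v) * f u)"
    unfolding incidence_def edges_into_def
    by (intro sum.cong refl) (simp add: conj_ac)
  also have "\<dots> = (\<Sum>i\<in>UNIV. real (incidence B (Suc (Suc k)) (vtx (Suc k) i) v) * f (vtx (Suc k) i))"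
    by (rule sum.reindex_bij_betw[OF bij_vtx, symmetric])
  finally show ?thesis .
qed

lemma card_edges_into_1: "card (edges_into B (Suc 0) (vtx (Suc 0) i)) = 1"
proof -
  obtain v0 where v0: "verts B 0 = {v0}" using ex_root by blast
  have "edges_into B (Suc 0) (vtx (Suc 0) i) = {e \<in> edges B (Suc 0). src B e = v0 \<and> rng B e = vtx (Suc 0) i}"
    unfolding edges_into_def using src_edge[of _ 0] v0 by auto
  then show ?thesis using incidence_1[of v0 i] v0 unfolding incidence_def by simp
qed

text \<open>The recursion for \<open>height\<close> multiplies the row of heights by the incidence
  matrix from the right; at level 1 every vertex has a single incoming edge and hence height
  1.\<close>

lemma height_vtx: "real (height B (Suc k) (vtx (Suc k) j)) = ((\<chi> i. 1) v* prefix_mat k) $ j"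
proof (induction k arbitrary: j)
  case 0
  then show ?case using card_edges_into_1 by (simp add: matA_word_prefix_0)
next
  case (Suc k)
  have "real (height B (Suc (Suc k)) (vtx (Suc (Suc k)) j)) =
      (\<Sum>e\<in>edges_into B (Suc (Suc k)) (vtx (Suc (Suc k)) j). real (height B (Suc k) (src B e)))"
    unfolding height.simps(2)[of B "Suc k"] of_nat_sum ..
  also have "\<dots> = (((\<chi> i. 1) v* prefix_mat k) v* matA (w k)) $ j"
    unfolding sum_edges_into[where f = "\<lambda>u. real (height B (Suc k) u)"] incidence_Suc Suc
    by (simp only: vector_matrix_mult_def[of _ "matA (w k)"] vec_lambda_beta mult.commute)
  finally show ?case by (simp add: matA_word_prefix_Suc vector_matrix_mul_assoc)
qed

text \<open>Only three matrices occur, so their absolute entry sums bound all column sums; the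
  summand 1 in \<open>K\<close> serves level 1.\<close>

lemma ex_edges_into_bound: "\<exists>K. \<forall>k. \<forall>v\<in>verts B (Suc k). card (edges_into B (Suc k) v) \<le> K"
proof -
  define C where "C l = (\<Sum>i\<in>UNIV. \<Sum>j\<in>UNIV. \<bar>matA l $ i $ j\<bar>)" for l
  define K where "K = 1 + nat \<lceil>C 1 + C 2 + C 3\<rceil>"
  have C0: "C l \<ge> 0" for l unfolding C_def by (intro sum_nonneg) auto
  have K: "1 + (C 1 + C 2 + C 3) \<le> real K" unfolding K_def using C0[of 1] C0[of 2] C0[of 3] by linarith
  have "card (edges_into B (Suc k) (vtx (Suc k) j)) \<le> K" for k j
  proof (cases k)
    case 0
    then show ?thesis using card_edges_into_1 unfolding K_def by simp
  next
    case (Suc l)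
    have "real (card (edges_into B (Suc k) (vtx (Suc k) j))) =
        (\<Sum>e\<in>edges_into B (Suc k) (vtx (Suc k) j). (\<lambda>_. 1) (src B e))" by simp
    also have "\<dots> = (\<Sum>i\<in>UNIV. matA (w l) $ i $ j)"
      unfolding Suc sum_edges_into[where f = "\<lambda>_. 1"] incidence_Suc by simp
    also have "\<dots> \<le> C (w l)"
      unfolding C_def
    proof (rule sum_mono)
      show "matA (w l) $ i $ j \<le> (\<Sum>j\<in>UNIV. \<bar>matA (w l) $ i $ j\<bar>)" for i
        using member_le_sum[of j UNIV "\<lambda>j. \<bar>matA (w l) $ i $ j\<bar>"] by simp
    qed
    also have "\<dots> \<le> real K"
    proof -
      have "w l = 1 \<or> w l = 2 \<or> w l = 3" using letters[of l] by auto
      then show ?thesis using K C0[of 1] C0[of 2] C0[of 3] by (elim disjE) simp_all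
    qed
    finally show ?thesis by simp
  qed
  then have "\<forall>v\<in>range (vtx (Suc k)). card (edges_into B (Suc k) v) \<le> K" for k by blast
  then show ?thesis unfolding bij_betw_imp_surj_on[OF bij_vtx] by blast
qed

section \<open>Masses as vectors, and the group of integrals\<close>

definition mass_vec :: "'x measure \<Rightarrow> nat \<Rightarrow> real^3" where
  "mass_vec \<mu> k = (\<chi> i. measure \<mu> (cyl (Suc k) (vtx (Suc k) i) 0))"

lemma measure_vectors_mass_vec:
  assumes "\<mu> \<in> invariant_measures X T"
  shows "measure_vectors (mass_vec \<mu>)"
proof -
  interpret invariant_measure B X T \<phi> \<mu> by unfold_locales (rule assms)
  have mv: "mass_vec \<mu> k $ i = mass (Suc k) (vtx (Suc k) i)" for k i
    unfolding mass_vec_def mass_def by simp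
  obtain v0 where v0: "verts B 0 = {v0}" using ex_root by blast
  show ?thesis
    unfolding measure_vectors_def
  proof (intro conjI allI)
    show "mass_vec \<mu> k = matA (w k) *v mass_vec \<mu> (Suc k)" for k
    proof -
      have "mass_vec \<mu> k $ i = (matA (w k) *v mass_vec \<mu> (Suc k)) $ i" for i
        unfolding mv mass_Suc[OF vtx_verts height_pos[OF vtx_verts], of k i]
          sum_edges_from[where f = "mass (Suc (Suc k))"]
        by (simp add: incidence_Suc matrix_vector_mult_def mv)
      then show ?thesis by (simp add: vec_eq_iff)
    qed
    show "0 \<le> mass_vec \<mu> k $ i" "mass_vec \<mu> k $ i \<le> 1" for k i
      unfolding mass_vec_def by auto
    \<comment> \<open>The cylinder of the root is the whole space; it splits over the single edges
      to the three vertices of level 1.\<close>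
    show "(\<Sum>i\<in>UNIV. mass_vec \<mu> 0 $ i) = 1"
      using mass_Suc[of v0 0] mass_0[of v0] v0 sum_edges_from[of "mass (Suc 0)" 0 v0]
      by (simp add: mv incidence_1)
  qed
qed

lemma unique_invariant_measure:
  assumes "\<mu> \<in> invariant_measures X T" "\<mu>' \<in> invariant_measures X T"
  shows "\<mu> = \<mu>'"
proof -
  interpret m: invariant_measure B X T \<phi> \<mu> by unfold_locales (rule assms)
  interpret m': invariant_measure B X T \<phi> \<mu>' by unfold_locales (rule assms)
  have eq: "mass_vec \<mu> = mass_vec \<mu>'"
    using assms measure_vectors_mass_vec measure_vectors_unique by blast
  have "m.mass k v = m'.mass k v" if v: "v \<in> verts B k" for k v
  proof (cases k)
    case 0
    then show ?thesis using v m.mass_0 m'.mass_0 by simp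
  next
    case (Suc l)
    then obtain i where "v = vtx (Suc l) i" using v bij_betw_imp_surj_on[OF bij_vtx[of l]] by blast
    moreover have "mass_vec \<mu> l $ i = mass_vec \<mu>' l $ i" using eq by simp
    ultimately show ?thesis unfolding mass_vec_def m.mass_def m'.mass_def Suc by simp
  qed
  then show ?thesis
    by (intro invariant_measure_eqI m.invariant_measure_axioms m'.invariant_measure_axioms)
qed

lemma integral_in_subgroup:
  assumes \<mu>: "\<mu> \<in> invariant_measures X T"
    and f: "continuous_map X (discrete_topology (UNIV :: int set)) f"
  shows "\<exists>(c :: 3 \<Rightarrow> int) k. (\<integral>x. real_of_int (f x) \<partial>\<mu>) = (\<Sum>i\<in>UNIV. of_int (c i) * mass_vec \<mu> k $ i)"
proof -
  interpret invariant_measure B X T \<phi> \<mu> by unfold_locales (rule \<mu>)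
  obtain N where N: "\<forall>x\<in>topspace X. \<forall>y\<in>topspace X. agree N x y \<longrightarrow> f x = f y"
    using continuous_discrete_agree[OF f] by blast
  \<comment> \<open>Level \<open>Suc N\<close> is used instead of \<open>N\<close>, since the labels
    \<open>vtx\<close> start at level 1.\<close>
  obtain c :: "'v \<Rightarrow> int" where
    "(\<integral>x. real_of_int (f x) \<partial>\<mu>) = (\<Sum>v\<in>verts B (Suc N). of_int (c v) * mass (Suc N) v)"
    using integral_locally_constant[of "Suc N" f] N agree_mono[of "Suc N" _ _ N] by (meson le_SucI order_refl)
  also have "\<dots> = (\<Sum>i\<in>UNIV. of_int (c (vtx (Suc N) i)) * mass (Suc N) (vtx (Suc N) i))"
    by (rule sum.reindex_bij_betw[OF bij_vtx, symmetric])
  finally show ?thesis unfolding mass_vec_def mass_def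
    by (intro exI[of _ "\<lambda>i. c (vtx (Suc N) i)"] exI[of _ N]) simp
qed

text \<open>With \<open>\<alpha> = p \<bullet> m 0\<close>, the vector \<open>\<alpha> h - p\<close> for \<open>h = (1, 1, 1)\<close> is orthogonal to \<open>m 0\<close>, so its images
  under the prefix matrices are summable; they differ from \<open>\<alpha>\<close> times the heights by integers.\<close>

lemma eigenvalue_of_integer_vector:
  assumes m: "measure_vectors m" and p: "\<And>i. p $ i \<in> \<int>"
  shows "continuous_eigenvalue X T (circle_exp (p \<bullet> m 0))"
proof -
  define \<alpha> where "\<alpha> = p \<bullet> m 0"
  define z where "z = (\<chi> i. \<alpha>) - p"
  have z: "z \<bullet> m 0 = 0"
  proof -
    have "(\<chi> i. \<alpha>) \<bullet> m 0 = \<alpha> * (\<Sum>i\<in>UNIV. m 0 $ i)" by (simp add: inner_vec_def sum_distrib_left)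
    then show ?thesis unfolding z_def using measure_vectorsD(4)[OF m] by (simp add: inner_diff_left \<alpha>_def)
  qed
  \<comment> \<open>At level 0 the height is 1, so the value \<alpha> leaves the integer 0; at level
    \<open>Suc l\<close>, inverting \<open>vtx\<close> selects the coordinate.\<close>
  define eps where "eps k v = (case k of 0 \<Rightarrow> \<alpha> | Suc l \<Rightarrow> (z v* prefix_mat l) $ (inv (vtx (Suc l)) v))" for k v
  define b where "b k = (case k of 0 \<Rightarrow> \<bar>\<alpha>\<bar> | Suc l \<Rightarrow> infnorm (z v* prefix_mat l))" for k
  have inv: "inv (vtx (Suc l)) (vtx (Suc l) i) = i" for l i
    using bij_betw_imp_inj_on[OF bij_vtx] by (rule inv_f_f)
  have surj: "\<exists>i. v = vtx (Suc l) i" if "v \<in> verts B (Suc l)" for l v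
    using that bij_betw_imp_surj_on[OF bij_vtx[of l]] by blast
  obtain K where K: "\<And>k v. v \<in> verts B (Suc k) \<Longrightarrow> card (edges_into B (Suc k) v) \<le> K"
    using ex_edges_into_bound by blast
  have "continuous_eigenvalue X T (circle_exp \<alpha>)"
  proof (rule continuous_eigenvalue_circle_exp[OF _ _ _ K])
    fix k v assume v: "v \<in> verts B k"
    show "\<bar>eps k v\<bar> \<le> b k"
      unfolding eps_def b_def by (cases k) (auto intro: component_le_infnorm_cart)
    show "\<alpha> * real (height B k v) - eps k v \<in> \<int>"
    proof (cases k)
      case (Suc l)
      then obtain i where i: "v = vtx (Suc l) i" using v surj by blast
      have "\<alpha> * ((\<chi> i. 1) v* prefix_mat l) $ i - (z v* prefix_mat l) $ i = (p v* prefix_mat l) $ i"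
        unfolding z_def vector_matrix_mult_def
        by (simp add: sum_distrib_left sum_subtractf[symmetric] algebra_simps)
      then show ?thesis unfolding Suc i eps_def height_vtx
        using vec_mult_prefix_Ints[OF p] by (simp add: inv)
    qed (simp add: eps_def)
  next
    have "summable (\<lambda>k. b (Suc k))" using summable_infnorm_prefix[OF m z] by (simp add: b_def)
    then show "summable b" by (simp add: summable_Suc_iff)
  qed
  then show ?thesis by (simp add: \<alpha>_def)
qed

end

theorem proposition34:
  fixes w :: "nat \<Rightarrow> nat"
    and n :: "nat \<Rightarrow> nat"
    and X :: "'x topology"
    and T :: "'x \<Rightarrow> 'x"
    and B :: "('v, 'e) bratteli"
    and vtx :: "nat \<Rightarrow> 3 \<Rightarrow> 'v"
  assumes letters: "\<And>k. w k \<in> {1, 2, 3}"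
    and infinitely_many_3: "infinite {k. w k = 3}"
    and n_increasing: "strict_mono n"
    and n_positive: "\<And>j. n j > 0"
    and summable_norms:
      "summable (\<lambda>j. (real (n (Suc j)) - real (n j)) *
         mnorm_on (matA_word (prefix_word w (n j))) (coneD_word (prefix_word w (n j))))"
    and system: "minimal_cantor_system X T"
    and representation: "bratteli_vershik_representation B X T"
    and rank: "finite_rank B"
    and matrices: "has_incidence_matrices B vtx (\<lambda>k. matA (w (k - 2)))"
  shows "uniquely_ergodic X T \<and>
    (\<exists>\<nu> \<in> coneD. rationally_independent \<nu> \<and>
       eigenvalue_group X T = integral_image_group X T \<and>
       integral_image_group X T =
         {of_int a * \<nu> $ 1 + of_int b * \<nu> $ 2 + of_int c | a b c :: int. True})"
proof -
  have proper: "properly_ordered B" and "conjugate_systems X T (path_space B) (vershik_map B)"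
    using representation unfolding bratteli_vershik_representation_def by auto
  then obtain \<phi> where \<phi>: "homeomorphic_map X (path_space B) \<phi>"
    "\<And>x. x \<in> topspace X \<Longrightarrow> \<phi> (T x) = vershik_map B (\<phi> x)"
    unfolding conjugate_systems_def by blast
  let ?C = "product_topology (\<lambda>_ :: nat. discrete_topology (UNIV :: bool set)) UNIV"
  have cantor: "X homeomorphic_space ?C" and homeo: "homeomorphic_map X X T"
    and min: "\<And>x. x \<in> topspace X \<Longrightarrow> X closure_of (full_orbit X T x) = topspace X"
    using system unfolding minimal_cantor_system_def cantor_set_def by auto
  have "compact_space ?C" by (simp add: compact_space_product_topology compact_space_discrete_topology)
  then have compact: "compact_space X" using homeomorphic_compact_space[OF cantor] by blast
  have nonempty: "topspace X \<noteq> {}"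
  proof
    assume "topspace X = {}"
    then have "?C = trivial_topology" using homeomorphic_empty_space[OF cantor] by simp
    then have "topspace ?C = {}" by (metis topspace_discrete_topology)
    moreover have "(\<lambda>_. True) \<in> topspace ?C" unfolding topspace_product_topology by simp
    ultimately show False by blast
  qed
  interpret matrix_system B X T \<phi> w n vtx
    by unfold_locales (use proper \<phi> compact nonempty homeo letters infinitely_many_3 n_increasing
        summable_norms matrices in \<open>auto simp: properly_ordered_def\<close>)
  obtain \<mu> where \<mu>: "\<mu> \<in> invariant_measures X T" using ex_invariant_measure by blast
  \<comment> \<open>The intersection in \<open>integral_image_group\<close> thereby runs over a
    single measure.\<close>
  then have unique: "invariant_measures X T = {\<mu>}" using unique_invariant_measure by blast
  interpret invariant_measure B X T \<phi> \<mu> by unfold_locales (rule \<mu>)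
  define m where "m = mass_vec \<mu>"
  have m: "measure_vectors m" unfolding m_def by (rule measure_vectors_mass_vec[OF \<mu>])
  \<comment> \<open>As the entries of \<open>m 0\<close> sum to 1, this is also the group generated
    by its three entries.\<close>
  define G where "G = {of_int a * m 0 $ 1 + of_int b * m 0 $ 2 + of_int c | a b c :: int. True}"
  have sum1: "m 0 $ 1 + m 0 $ 2 + m 0 $ 3 = 1" using measure_vectorsD(4)[OF m] by (simp add: sum_3)
  have G_diff: "x - y \<in> G" if "x \<in> G" "y \<in> G" for x y
  proof -
    obtain a b c a' b' c' :: int where "x = of_int a * m 0 $ 1 + of_int b * m 0 $ 2 + of_int c"
      "y = of_int a' * m 0 $ 1 + of_int b' * m 0 $ 2 + of_int c'"
      using \<open>x \<in> G\<close> \<open>y \<in> G\<close> unfolding G_def by blast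
    then have "x - y = of_int (a - a') * m 0 $ 1 + of_int (b - b') * m 0 $ 2 + of_int (c - c')"
      by (simp add: algebra_simps)
    then show ?thesis unfolding G_def by blast
  qed
  have G_gen: "m 0 $ i \<in> G" for i
  proof -
    have "m 0 $ 1 = of_int 1 * m 0 $ 1 + of_int 0 * m 0 $ 2 + of_int 0"
      "m 0 $ 2 = of_int 0 * m 0 $ 1 + of_int 1 * m 0 $ 2 + of_int 0"
      "m 0 $ 3 = of_int (- 1) * m 0 $ 1 + of_int (- 1) * m 0 $ 2 + of_int 1" using sum1 by auto
    then have "m 0 $ 1 \<in> G" "m 0 $ 2 \<in> G" "m 0 $ 3 \<in> G" unfolding G_def by blast+
    then show ?thesis using exhaust_3[of i] by auto
  qed
  have G_m: "m k $ i \<in> G" for k i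
    by (rule measure_vectors_subgroup[OF m G_gen G_diff])
  have G_0: "0 \<in> G" using G_diff[OF G_gen[of 1] G_gen[of 1]] by simp
  have G_add: "x + y \<in> G" if "x \<in> G" "y \<in> G" for x y
    using G_diff[OF that(1) G_diff[OF G_0 that(2)]] by simp
  have G_mult: "of_int c * x \<in> G" if x: "x \<in> G" for c :: int and x
  proof (induction c rule: int_induct[where k = 0])
    case (step1 i)
    then show ?case using G_add[OF _ x] by (simp add: distrib_right)
  next
    case (step2 i)
    then show ?case using G_diff[OF _ x] by (simp add: left_diff_distrib)
  qed (simp add: G_0)
  \<comment> \<open>The three groups are compared in a cycle: integrals lie in \<open>G\<close>,
    elements of \<open>G\<close> are eigenvalues, and eigenvalues are integrals.\<close>
  have IG: "integral_image_group X T \<subseteq> G"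
  proof
    fix \<alpha> assume "\<alpha> \<in> integral_image_group X T"
    then obtain f where f: "continuous_map X (discrete_topology (UNIV :: int set)) f"
      "\<alpha> = (\<integral>x. real_of_int (f x) \<partial>\<mu>)"
      unfolding integral_image_group_def unique by auto
    obtain c k where "\<alpha> = (\<Sum>i\<in>UNIV. of_int (c i) * m k $ i)"
      using integral_in_subgroup[OF \<mu> f(1)] f(2) unfolding m_def by auto
    then show "\<alpha> \<in> G" by (simp add: sum_3 G_add G_mult G_m)
  qed
  have GE: "G \<subseteq> eigenvalue_group X T"
  proof
    fix \<alpha> assume "\<alpha> \<in> G"
    then obtain a b c :: int where \<alpha>: "\<alpha> = of_int a * m 0 $ 1 + of_int b * m 0 $ 2 + of_int c"
      unfolding G_def by blast
    \<comment> \<open>The integer \<open>c\<close> is spread over all three coordinates, because 1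
      is the sum of the entries of \<open>m 0\<close>.\<close>
    let ?p = "vector [of_int (a + c), of_int (b + c), of_int c] :: real^3"
    have "?p \<bullet> m 0 = of_int a * m 0 $ 1 + of_int b * m 0 $ 2 + of_int c * (m 0 $ 1 + m 0 $ 2 + m 0 $ 3)"
      by (simp add: inner_vec_def sum_3 algebra_simps)
    then have "\<alpha> = ?p \<bullet> m 0" using sum1 \<alpha> by simp
    moreover have "\<forall>i. ?p $ i \<in> \<int>" by (simp add: forall_3)
    ultimately show "\<alpha> \<in> eigenvalue_group X T"
      unfolding eigenvalue_group_def circle_exp_def[symmetric] using eigenvalue_of_integer_vector[OF m, of ?p] by simp
  qed
  have EI: "eigenvalue_group X T \<subseteq> integral_image_group X T"
    using eigenvalue_integral[OF min]
    unfolding eigenvalue_group_def circle_exp_def[symmetric] integral_image_group_def unique by fastforce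
  have "uniquely_ergodic X T" unfolding uniquely_ergodic_def unique by simp
  moreover have "m 0 \<in> coneD" by (rule measure_vectors_coneD[OF m])
  moreover have "rationally_independent (m 0)" by (rule measure_vectors_rationally_independent[OF m])
  moreover have "eigenvalue_group X T = integral_image_group X T" "integral_image_group X T = G"
    using IG GE EI by auto
  ultimately show ?thesis unfolding G_def by blast
qed

end
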